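(* Let $(X,T)$ be a topological dynamical system satisfying the specification property, let $\mathcal{F}=\{f_n\}_{n\ge1}$ and $\Phi=\{\varphi_n\}_{n\ge1}$ be asymptotically additive potentials on $X$, and let $\mathcal{G}=\{g_n\}_{n\ge1}$ and $\Psi=\{\psi_n\}_{n\ge1}$ be asymptotically additive potentials on $X$ for which there is a constant $\sigma>0$ with $\frac1n g_n(x)\ge\sigma$ and $\frac1n\psi_n(x)\ge\sigma$ for all $n\in\mathbb{N}$, $x\in X$. Assume $\inf_{\mu\in\mathcal{M}_T}\frac{\Phi_*(\mu)}{\Psi_*(\mu)}<\sup_{\mu\in\mathcal{M}_T}\frac{\Phi_*(\mu)}{\Psi_*(\mu)}$. Then $$\sup\Big\{\frac{\mathcal{F}_*(\mu)}{\mathcal{G}_*(\mu)}:\mu\in\mathcal{E}_T\Big\}=\sup\Big\{\frac{\mathcal{F}_*(\mu)}{\mathcal{G}_*(\mu)}:\mu\in\mathcal{M}_T\Big\}=\sup\Big\{\frac{\mathcal{F}_*(\mu)}{\mathcal{G}_*(\mu)}:\mu\in\bigcup_{x\in\widehat{X}_{\Phi,\Psi}}\mathcal{V}(x)\Big\}=\sup_{x\in\widehat{X}_{\Phi,\Psi}}\limsup_{n\to\infty}\frac{f_n(x)}{g_n(x)}.$$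
   Context: $X$ is a compact metric space with metric $d$ and $T:X\to X$ is continuous. $\mathcal{M}_T$ denotes the set of $T$-invariant Borel probability measures on $X$ and $\mathcal{E}_T$ the ergodic ones. For $f\in C(X)$, $S_nf=\sum_{i=0}^{n-1}f\circ T^i$. A sequence $\mathcal{F}=\{f_n\}_{n\ge1}\subset C(X)$ is an asymptotically additive potential (AAP) if for every $\xi>0$ there is $f_\xi\in C(X)$ with $\limsup_{n\to\infty}\frac1n\|f_n-S_nf_\xi\|_\infty<\xi$; for $\mu\in\mathcal{M}_T$, $\mathcal{F}_*(\mu)=\lim_{n\to\infty}\frac1n\int f_n\,d\mu$ (this limit exists). $\widehat{X}_{\Phi,\Psi}=\{x\in X:\lim_{n\to\infty}\varphi_n(x)/\psi_n(x)\text{ does not exist}\}$. For $x\in X$, $\mathcal{V}(x)$ is the set of weak$^*$ limit points of $\delta_{x,n}=\frac1n\sum_{i=0}^{n-1}\delta_{T^ix}$. $(X,T)$ has the specification property if for every $\epsilon>0$ there is an integer $m(\epsilon)$ such that for any finite collection of intervals $[a_j,b_j]\subset\mathbb{N}$, $j=1,\dots,k$, with $a_{j+1}-b_j\ge m(\epsilon)$ for $j=1,\dots,k-1$, and any $x_1,\dots,x_k\in X$, there is $x\in X$ with $d(T^{p+a_j}x,T^px_j)<\epsilon$ for all $p=0,1,\dots,b_j-a_j$ and all $j$. *)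

theory Defs
  imports "HOL-Probability.Probability"
begin

text \<open>The compact metric space X is represented by a type 'a with compact UNIV.\<close>

definition birkhoff_sum :: "('a \<Rightarrow> 'a) \<Rightarrow> nat \<Rightarrow> ('a \<Rightarrow> real) \<Rightarrow> 'a \<Rightarrow> real" where
  "birkhoff_sum T n h x = (\<Sum>i<n. h ((T ^^ i) x))"

text \<open>Asymptotically additive potential (indices n \<ge> 1 matter; f 0 is irrelevant).\<close>
definition AAP :: "('a::metric_space \<Rightarrow> 'a) \<Rightarrow> (nat \<Rightarrow> 'a \<Rightarrow> real) \<Rightarrow> bool" where
  "AAP T f \<longleftrightarrow> (\<forall>n\<ge>1. continuous_on UNIV (f n)) \<and>
     (\<forall>\<xi>>0. \<exists>h. continuous_on UNIV h \<and>
        limsup (\<lambda>n. ereal ((SUP x. \<bar>f n x - birkhoff_sum T n h x\<bar>) / real n)) < ereal \<xi>)"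

definition pot_star :: "(nat \<Rightarrow> 'a \<Rightarrow> real) \<Rightarrow> 'a measure \<Rightarrow> real" where
  "pot_star f \<mu> = lim (\<lambda>n. (\<integral>x. f n x \<partial>\<mu>) / real n)"

definition invariant_measures :: "('a::topological_space \<Rightarrow> 'a) \<Rightarrow> 'a measure set" where
  "invariant_measures T = {\<mu>. prob_space \<mu> \<and> sets \<mu> = sets borel \<and> T \<in> measurable \<mu> \<mu> \<and>
     (\<forall>A\<in>sets \<mu>. emeasure \<mu> (T -` A \<inter> space \<mu>) = emeasure \<mu> A)}"

definition ergodic_measures :: "('a::topological_space \<Rightarrow> 'a) \<Rightarrow> 'a measure set" where
  "ergodic_measures T = {\<mu>. \<mu> \<in> invariant_measures T \<and>
     (\<forall>A\<in>sets borel. T -` A = A \<longrightarrow> measure \<mu> A = 0 \<or> measure \<mu> A = 1)}"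

definition irregular_set :: "(nat \<Rightarrow> 'a \<Rightarrow> real) \<Rightarrow> (nat \<Rightarrow> 'a \<Rightarrow> real) \<Rightarrow> 'a set" where
  "irregular_set \<phi> \<psi> = {x. \<not> convergent (\<lambda>n. \<phi> n x / \<psi> n x)}"

text \<open>V(x): weak* limit points of the empirical measures
  delta_{x,n} = (1/n) sum_{i<n} delta_{T^i x}; the integral of a continuous f
  against delta_{x,n} is written out as the Birkhoff average.\<close>
definition empirical_limits :: "('a::metric_space \<Rightarrow> 'a) \<Rightarrow> 'a \<Rightarrow> 'a measure set" where
  "empirical_limits T x = {\<mu>. prob_space \<mu> \<and> sets \<mu> = sets borel \<and>
     (\<exists>r. strict_mono r \<and> (\<forall>f::'a \<Rightarrow> real. continuous_on UNIV f \<longrightarrow>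
        (\<lambda>k. birkhoff_sum T (r k) f x / real (r k)) \<longlonglongrightarrow> (\<integral>y. f y \<partial>\<mu>)))}"

definition specification_property :: "('a::metric_space \<Rightarrow> 'a) \<Rightarrow> bool" where
  "specification_property T \<longleftrightarrow> (\<forall>\<epsilon>>0. \<exists>m::nat. \<forall>(k::nat) (a::nat \<Rightarrow> nat) (b::nat \<Rightarrow> nat) (xs::nat \<Rightarrow> 'a).
     (\<forall>j<k. a j \<le> b j) \<and> (\<forall>j. Suc j < k \<longrightarrow> b j + m \<le> a (Suc j)) \<longrightarrow>
     (\<exists>x. \<forall>j<k. \<forall>p\<le>b j - a j. dist ((T ^^ (p + a j)) x) ((T ^^ p) (xs j)) < \<epsilon>))"

end

(* The last two suprema are compared pointwise: for each x, limsup f_n(x)/g_n(x) is the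
   maximum of F_*/G_* over V(x), because V(x) consists of the weak-star limits along subsequences.
   Given an invariant measure mu with c = F_*(mu)/G_*(mu), Fatou yields a point y0 whose orbit has
   (f_n - c g_n)/n almost nonnegative infinitely often; likewise two invariant measures on which
   Phi_*/Psi_* lies on different sides of some b yield y1, y2 with (phi_n - b psi_n)/n infinitely
   often at least eta resp. at most -eta, for some eta > 0. A point shadowing longer and longer
   segments of the orbits of y0, y1, y2 in turn is irregular and has limsup f_n/g_n at least c - tau.

   Ergodic measures: integral of h plus a small multiple of a strictly convex weak-star continuous
   functional attains its maximum over the invariant measures only at extreme points, and these are
   ergodic. Compactness comes from Helly selection on the line, to which the space is transported
   by coding its points as ternary expansions. *)
theory Submission
  imports Defs
begin

text \<open>A ratio is not linear in the measure, so it is never maximised or shadowed directly.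
  With \<open>c\<close> the ratio at \<open>mu\<close>, the combination \<open>f - c g\<close> is
  again asymptotically additive and has mean zero at \<open>mu\<close>; the lower bound \<sigma> on
  \<open>g n / n\<close> turns an additive error \<tau>\<sigma> into an error \<tau> of the ratio.
  Likewise an upper bound on \<open>\<psi> n / n\<close> reads divergence of the ratio off the two
  signs of \<open>\<phi> - b \<psi>\<close>.

  The measures involved need not be ergodic, so they need not be limits along any orbit. But a
  limsup and a failure of convergence only ask for infinitely many good times. This is why Fatou is
  enough and why several orbits can share one shadowing point by turns. The shadowing radius stays
  fixed along the way, which keeps the gaps constant and costs a fixed small loss, hence the \<tau>.

  The code of a point need not depend continuously on the point. Its inverse is uniformly
  continuous, though, and that is the direction in which a limit measure has to be carried back from
  the line.\<close>

section \<open>Coding compact metric spaces by reals\<close>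

lemma compact_continuous_bounded:
  fixes h :: "'a::metric_space \<Rightarrow> real"
  assumes "compact (UNIV :: 'a set)" "continuous_on UNIV h"
  obtains C where "C > 0" "\<And>x. \<bar>h x\<bar> \<le> C"
proof -
  have "bounded (range h)"
    using assms compact_continuous_image compact_imp_bounded by blast
  then show thesis
    using that unfolding bounded_pos by auto
qed

text \<open>Tents of height and radius \<open>1 / Suc n\<close> over a finite net, for every
  \<open>n\<close>. They serve twice: the tents that are positive at a point give the digits of its
  code, and the sets where they are positive form a base of the topology.\<close>

lemma compact_countable_tents:
  assumes cpt: "compact (UNIV :: 'a::metric_space set)"
  obtains t :: "nat \<Rightarrow> 'a::metric_space \<Rightarrow> real" where
    "\<And>k. continuous_on UNIV (t k)" "\<And>k x. t k x \<ge> 0"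
    "\<And>\<epsilon>. \<epsilon> > 0 \<Longrightarrow> \<exists>N. \<forall>x. \<exists>k<N. t k x > 0 \<and> (\<forall>y. t k y > 0 \<longrightarrow> dist x y < \<epsilon>)"
proof -
  have "\<forall>n. \<exists>D. finite D \<and> (UNIV :: 'a set) \<subseteq> (\<Union>d\<in>D. ball d (1 / real (Suc n)))"
    using cpt unfolding compact_eq_totally_bounded by (metis of_nat_0_less_iff zero_less_Suc zero_less_divide_1_iff)
  then obtain D where D: "\<And>n. finite (D n)" "\<And>n. (UNIV :: 'a set) \<subseteq> (\<Union>d\<in>D n. ball d (1 / real (Suc n)))"
    by metis
  define C where "C = (SIGMA n:UNIV. D n)"
  have C: "countable C" "C \<noteq> {}"
    using D(1) D(2)[of 0] by (auto simp: C_def intro: countable_finite)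
  define t where "t k x = (case from_nat_into C k of (n, d) \<Rightarrow> max 0 (1 / real (Suc n) - dist x d))" for k x
  have t_to: "t (to_nat_on C (n, d)) x = max 0 (1 / real (Suc n) - dist x d)" if "d \<in> D n" for n d x
    using that C by (simp add: t_def C_def)
  show thesis
  proof
    show "continuous_on UNIV (t k)" for k
      unfolding t_def by (cases "from_nat_into C k") (auto intro!: continuous_intros)
    show "t k x \<ge> 0" for k x
      by (auto simp: t_def split: prod.splits)
    show "\<exists>N. \<forall>x. \<exists>k<N. t k x > 0 \<and> (\<forall>y. t k y > 0 \<longrightarrow> dist x y < \<epsilon>)" if \<epsilon>: "\<epsilon> > 0" for \<epsilon> :: real
    proof -
      obtain n where n: "1 / real (Suc n) < \<epsilon> / 2"
        \<comment> \<open>Two points under one tent are less than two radii apart, whence the half.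
          The net is finite, so one \<open>N\<close> serves all points.\<close>
        using \<epsilon> nat_approx_posE half_gt_zero by blast
      define N where "N = Suc (Max ((\<lambda>d. to_nat_on C (n, d)) ` D n))"
      have "\<exists>k<N. t k x > 0 \<and> (\<forall>y. t k y > 0 \<longrightarrow> dist x y < \<epsilon>)" for x
      proof -
        obtain d where d: "d \<in> D n" "dist d x < 1 / real (Suc n)"
          using subsetD[OF D(2)[of n] UNIV_I[of x]] by auto
        have "to_nat_on C (n, d) < N"
          unfolding N_def less_Suc_eq_le using d D(1) by (intro Max_ge) auto
        moreover have "t (to_nat_on C (n, d)) x > 0"
          using d by (simp add: t_to dist_commute)
        moreover have "dist x y < \<epsilon>" if "t (to_nat_on C (n, d)) y > 0" for y
        proof -
          have "dist y d < 1 / real (Suc n)"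
            using that d by (simp add: t_to)
          then show ?thesis
            using d n dist_triangle[of x y d] by (simp add: dist_commute)
        qed
        ultimately show ?thesis by blast
      qed
      then show ?thesis by blast
    qed
  qed
qed

text \<open>The first nonzero term has size \<open>2 * (1/3) ^ Suc n\<close>, and the geometric tail
  behind it amounts to at most half of this. For differences of digits 0 and 2 it says that nearby
  numbers have the same leading digits; binary digits would not give this, since a carry can change
  all of them.\<close>

lemma ternary_expansion_gap:
  fixes c :: "nat \<Rightarrow> real"
  assumes "\<And>k. \<bar>c k\<bar> \<le> 2" "\<And>k. k < n \<Longrightarrow> c k = 0" "\<bar>c n\<bar> = 2"
  shows "\<bar>\<Sum>k. c k * (1/3) ^ Suc k\<bar> \<ge> (1/3) ^ Suc n"
proof -
  have g: "summable (\<lambda>k. 2 * (1/3::real) ^ Suc k)"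
    by (intro summable_mult) (simp add: summable_geometric summable_mult)
  have nb: "norm (c k * (1/3) ^ Suc k) \<le> 2 * (1/3) ^ Suc k" for k
    using assms(1)[of k] by (simp add: abs_mult)
  have s: "summable (\<lambda>k. c k * (1/3) ^ Suc k)"
    by (rule summable_comparison_test'[OF g nb])
  have "(\<Sum>k. c k * (1/3) ^ Suc k)
     = (\<Sum>k. c (k + Suc n) * (1/3) ^ Suc (k + Suc n)) + (\<Sum>k<Suc n. c k * (1/3) ^ Suc k)"
    by (rule suminf_split_initial_segment[OF s])
  also have "(\<Sum>k<Suc n. c k * (1/3) ^ Suc k) = c n * (1/3) ^ Suc n"
    using assms(2) by simp
  finally have eq: "(\<Sum>k. c k * (1/3) ^ Suc k)
     = (\<Sum>k. c (k + Suc n) * (1/3) ^ Suc (k + Suc n)) + c n * (1/3) ^ Suc n" .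
  have "(\<Sum>k. 2 * (1/3::real) ^ Suc (k + Suc n)) = (\<Sum>k. (2/3 * (1/3) ^ Suc n) * (1/3) ^ k)"
    by (simp add: power_add mult_ac)
  also have "\<dots> = (1/3) ^ Suc n"
    by (subst suminf_mult) (auto simp: suminf_geometric summable_geometric)
  finally have tail: "(\<Sum>k. 2 * (1/3::real) ^ Suc (k + Suc n)) = (1/3) ^ Suc n" .
  have "\<bar>\<Sum>k. c (k + Suc n) * (1/3) ^ Suc (k + Suc n)\<bar> \<le> (1/3) ^ Suc n"
    using norm_suminf_le[OF nb summable_ignore_initial_segment[OF g], of "Suc n"]
    unfolding tail real_norm_def .
  moreover have "\<bar>c n * (1/3) ^ Suc n\<bar> = 2 * (1/3) ^ Suc n"
    by (simp add: abs_mult assms(3))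
  ultimately show ?thesis
    unfolding eq by linarith
qed

text \<open>A compact metric space is coded by ternary expansions: its points are the values of a
  continuous map \<open>\<pi>\<close> on a compact set of reals, with a Borel section \<open>e\<close>.\<close>
lemma compact_real_coding:
  assumes cpt: "compact (UNIV :: 'a::metric_space set)"
  obtains e :: "'a::metric_space \<Rightarrow> real" and K :: "real set" and \<pi> :: "real \<Rightarrow> 'a::metric_space" where
    "e \<in> borel_measurable borel" "closed K" "K \<subseteq> {0..1}" "range e \<subseteq> K"
    "continuous_on K \<pi>" "\<And>x. \<pi> (e x) = x"
proof -
  obtain t :: "nat \<Rightarrow> 'a \<Rightarrow> real" where
    t: "\<And>k. continuous_on UNIV (t k)"
    "\<And>\<epsilon>. \<epsilon> > 0 \<Longrightarrow> \<exists>N. \<forall>x. \<exists>k<N. t k x > 0 \<and> (\<forall>y. t k y > 0 \<longrightarrow> dist x y < \<epsilon>)"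
    using compact_countable_tents[OF cpt] by metis
  define b where "b k x = (if t k x > 0 then 2 else 0 :: real)" for k x
  define e where "e x = (\<Sum>k. b k x * (1/3) ^ Suc k)" for x
  have g: "(\<lambda>k. 2 * (1/3::real) ^ Suc k) sums 1"
    using sums_mult[OF geometric_sums[of "1/3::real"], of "2/3"] by (simp add: mult_ac)
  have sb: "summable (\<lambda>k. b k x * (1/3) ^ Suc k)" for x
    by (rule summable_comparison_test'[OF sums_summable[OF g]]) (auto simp: b_def)
  have "(\<lambda>x. b k x) \<in> borel_measurable borel" for k
    unfolding b_def using borel_measurable_continuous_onI[OF t(1)[of k]] by measurable
  then have e_meas: "e \<in> borel_measurable borel"
    unfolding e_def by (intro borel_measurable_suminf borel_measurable_times borel_measurable_const)
  have e01: "e x \<in> {0..1}" for x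
  proof -
    have "e x \<le> (\<Sum>k. 2 * (1/3::real) ^ Suc k)"
      unfolding e_def by (rule suminf_le[OF _ sb sums_summable[OF g]]) (auto simp: b_def)
    moreover have "0 \<le> e x"
      unfolding e_def by (rule suminf_nonneg[OF sb]) (auto simp: b_def)
    ultimately show ?thesis
      using sums_unique[OF g] by simp
  qed
  \<comment> \<open>If the codes differ before place \<open>N\<close>, the first place
    \<open>n\<close> where they do already separates them by \<open>(1/3) ^ Suc n\<close>.\<close>
  have e_agree: "b k x = b k y" if N: "\<bar>e x - e y\<bar> < (1/3) ^ N" and k: "k < N" for x y k N
  proof (rule ccontr)
    assume "b k x \<noteq> b k y"
    define P where "P i \<longleftrightarrow> b i x \<noteq> b i y" for i
    define n where "n = (LEAST i. P i)"
    have "P k"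
      using \<open>b k x \<noteq> b k y\<close> by (simp add: P_def)
    then have "P n" "n \<le> k"
      unfolding n_def by (rule LeastI, rule Least_le)
    moreover have "\<not> P i" if "i < n" for i
      using that unfolding n_def by (rule not_less_Least)
    ultimately have n: "b n x \<noteq> b n y" "n \<le> k" "\<And>i. i < n \<Longrightarrow> b i x = b i y"
      by (auto simp: P_def)
    have "e x - e y = (\<Sum>k. (b k x - b k y) * (1/3) ^ Suc k)"
      unfolding e_def suminf_diff[OF sb sb] by (simp only: left_diff_distrib)
    moreover have "(1/3) ^ Suc n \<le> \<bar>\<Sum>k. (b k x - b k y) * (1/3) ^ Suc k\<bar>"
      using n by (intro ternary_expansion_gap) (auto simp: b_def split: if_splits)
    moreover have "(1/3::real) ^ N \<le> (1/3) ^ Suc n"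
      using n k by (intro power_decreasing) auto
    ultimately show False
      using N by linarith
  qed
  \<comment> \<open>Uniform continuity of the inverse of \<open>e\<close>: among the first
    \<open>N\<close> tents one is positive at \<open>x\<close> and has small support, and agreement
    of the digits makes it positive at \<open>y\<close> too.\<close>
  have e_inv: "\<exists>\<delta>>0. \<forall>x y. \<bar>e x - e y\<bar> < \<delta> \<longrightarrow> dist x y < \<epsilon>" if \<epsilon>: "\<epsilon> > 0" for \<epsilon>
  proof -
    obtain N where N: "\<And>x. \<exists>k<N. t k x > 0 \<and> (\<forall>y. t k y > 0 \<longrightarrow> dist x y < \<epsilon>)"
      using t(2)[OF \<epsilon>] by blast
    have "dist x y < \<epsilon>" if "\<bar>e x - e y\<bar> < (1/3) ^ N" for x y
    proof -
      obtain k where k: "k < N" "t k x > 0" "\<And>y. t k y > 0 \<Longrightarrow> dist x y < \<epsilon>"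
        using N by blast
      then show ?thesis
        using e_agree[OF that k(1)] by (auto simp: b_def split: if_splits)
    qed
    then show ?thesis
      by (intro exI[of _ "(1/3) ^ N"]) auto
  qed
  \<comment> \<open>The range of \<open>e\<close> need not be closed. For the added points,
    \<open>\<pi>\<close> is chosen as a subsequential limit in the compact space.\<close>
  define K where "K = closure (range e)"
  have "\<exists>x s. (\<lambda>n. e (s n)) \<longlonglongrightarrow> u \<and> s \<longlonglongrightarrow> x" if "u \<in> K" for u
  proof -
    have "\<exists>v. (\<forall>n. v n \<in> range e) \<and> v \<longlonglongrightarrow> u"
      using that unfolding K_def closure_sequential .
    then obtain v where v: "\<forall>n. \<exists>x. v n = e x" "v \<longlonglongrightarrow> u"
      unfolding image_iff bex_UNIV by metis
    obtain s where s: "\<And>n. v n = e (s n)"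
      using choice[OF v(1)] by metis
    obtain x r where "strict_mono r" "(s \<circ> r) \<longlonglongrightarrow> x"
      using seq_compactE[OF cpt[unfolded compact_eq_seq_compact_metric], of s] by blast
    moreover have "(\<lambda>n. e ((s \<circ> r) n)) \<longlonglongrightarrow> u"
      using LIMSEQ_subseq_LIMSEQ[OF v(2) \<open>strict_mono r\<close>] s by (simp add: o_def)
    ultimately show ?thesis
      by blast
  qed
  then obtain \<pi> s where \<pi>: "\<And>u. u \<in> K \<Longrightarrow> (\<lambda>n. e (s u n)) \<longlonglongrightarrow> u" "\<And>u. u \<in> K \<Longrightarrow> s u \<longlonglongrightarrow> \<pi> u"
    by metis
  \<comment> \<open>One estimate for both remaining claims: two approximating sequences give
    continuity of \<open>\<pi>\<close>, and a constant second sequence gives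
    \<open>\<pi> (e x) = x\<close>.\<close>
  have \<pi>_dist: "dist x y \<le> \<epsilon>"
    if "(\<lambda>n. e (p n)) \<longlonglongrightarrow> u" "p \<longlonglongrightarrow> x" "(\<lambda>n. e (q n)) \<longlonglongrightarrow> v" "q \<longlonglongrightarrow> y" "\<bar>u - v\<bar> < \<delta>"
      and \<delta>: "\<forall>x y. \<bar>e x - e y\<bar> < \<delta> \<longrightarrow> dist x y < \<epsilon>" for p q u v x y \<epsilon> \<delta>
  proof -
    have "(\<lambda>n. \<bar>e (p n) - e (q n)\<bar>) \<longlonglongrightarrow> \<bar>u - v\<bar>"
      using that by (intro tendsto_intros)
    then have "\<forall>\<^sub>F n in sequentially. \<bar>e (p n) - e (q n)\<bar> < \<delta>"
      using that(5) by (rule order_tendstoD)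
    then have "\<forall>\<^sub>F n in sequentially. dist (p n) (q n) \<le> \<epsilon>"
      by eventually_elim (use \<delta> in \<open>auto intro: less_imp_le\<close>)
    moreover have "(\<lambda>n. dist (p n) (q n)) \<longlonglongrightarrow> dist x y"
      using that by (intro tendsto_intros)
    ultimately show ?thesis
      by (intro tendsto_upperbound) auto
  qed
  have "continuous_on K \<pi>"
    unfolding continuous_on_iff
  proof (intro ballI allI impI)
    fix u and \<epsilon> :: real assume u: "u \<in> K" and "0 < \<epsilon>"
    then obtain \<delta> where \<delta>: "\<delta> > 0" "\<forall>x y. \<bar>e x - e y\<bar> < \<delta> \<longrightarrow> dist x y < \<epsilon> / 2"
      using e_inv[of "\<epsilon> / 2"] by auto
    have "dist (\<pi> v) (\<pi> u) < \<epsilon>" if "v \<in> K" "dist v u < \<delta>" for v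
      using \<pi>_dist[OF \<pi>[OF that(1)] \<pi>[OF u] _ \<delta>(2)] that \<open>0 < \<epsilon>\<close> by (simp add: dist_real_def)
    then show "\<exists>\<delta>>0. \<forall>v\<in>K. dist v u < \<delta> \<longrightarrow> dist (\<pi> v) (\<pi> u) < \<epsilon>"
      using \<delta> by blast
  qed
  moreover have "\<pi> (e x) = x" for x
  proof -
    have "e x \<in> K"
      unfolding K_def by (rule subsetD[OF closure_subset rangeI])
    have "dist (\<pi> (e x)) x \<le> \<epsilon>" if \<epsilon>: "\<epsilon> > 0" for \<epsilon>
    proof -
      obtain \<delta> where \<delta>: "\<delta> > 0" "\<forall>x y. \<bar>e x - e y\<bar> < \<delta> \<longrightarrow> dist x y < \<epsilon>"
        using e_inv[OF \<epsilon>] by auto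
      then show ?thesis
        using \<pi>_dist[where q = "\<lambda>_. x", OF \<pi>[OF \<open>e x \<in> K\<close>] tendsto_const tendsto_const _ \<delta>(2)] \<delta>(1) by simp
    qed
    then have "dist (\<pi> (e x)) x \<le> 0"
      by (rule field_le_epsilon) simp
    then show ?thesis by simp
  qed
  moreover have "K \<subseteq> {0..1}"
    unfolding K_def using e01 by (intro closure_minimal) auto
  ultimately show thesis
    using e_meas by (intro that[of e K \<pi>]) (simp_all add: K_def closure_subset)
qed

section \<open>Weak-star sequential compactness\<close>

lemma continuous_integrable:
  fixes h :: "'a::metric_space \<Rightarrow> real"
  assumes "compact (UNIV :: 'a set)" "continuous_on UNIV h" "finite_measure \<mu>" "sets \<mu> = sets borel"
  shows "integrable \<mu> h"
proof -
  interpret finite_measure \<mu> by fact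
  obtain C where "\<And>x. \<bar>h x\<bar> \<le> C"
    using compact_continuous_bounded[OF assms(1,2)] by metis
  moreover have "h \<in> borel_measurable \<mu>"
    using borel_measurable_continuous_onI[OF assms(2)] measurable_cong_sets[OF assms(4) refl] by blast
  ultimately show ?thesis
    by (intro integrable_const_bound[of _ C]) auto
qed

text \<open>The images under \<open>e\<close> live on \<open>{0..1}\<close> and are therefore tight.
  A limit on the line is brought back by \<open>\<pi>\<close>; a test function \<open>h\<close> is
  replaced by a continuous extension \<open>H\<close> of \<open>h\<close> composed with
  \<open>\<pi>\<close>, which satisfies \<open>H (e x) = h x\<close> even where \<open>e\<close> is
  discontinuous.\<close>

theorem prob_measures_weak_seq_compact:
  fixes \<mu> :: "nat \<Rightarrow> 'a::metric_space measure"
  assumes cpt: "compact (UNIV :: 'a set)"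
    and \<mu>: "\<And>n. prob_space (\<mu> n)" "\<And>n. sets (\<mu> n) = sets borel"
  obtains r :: "nat \<Rightarrow> nat" and \<nu> where "strict_mono r" "prob_space \<nu>" "sets \<nu> = sets borel"
    "\<And>h :: 'a \<Rightarrow> real. continuous_on UNIV h \<Longrightarrow> (\<lambda>n. \<integral>x. h x \<partial>\<mu> (r n)) \<longlonglongrightarrow> (\<integral>x. h x \<partial>\<nu>)"
proof -
  obtain e :: "'a \<Rightarrow> real" and K :: "real set" and \<pi> where
    e: "e \<in> borel_measurable borel" and K: "closed K" "K \<subseteq> {0..1}" "range e \<subseteq> K"
    and \<pi>: "continuous_on K \<pi>" "\<And>x. \<pi> (e x) = x"
    using compact_real_coding[OF cpt] by metis
  have e_\<mu>: "e \<in> borel_measurable (\<mu> n)" for n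
    using e measurable_cong_sets[OF \<mu>(2) refl] by blast
  define M where "M n = distr (\<mu> n) borel e" for n
  have M_rd: "real_distribution (M n)" for n
    unfolding M_def using prob_space.prob_space_distr[OF \<mu>(1) e_\<mu>]
    by (intro real_distribution.intro real_distribution_axioms.intro) auto
  have "tight M"
    unfolding tight_def
  proof (intro conjI allI impI exI)
    show "real_distribution (M n)" for n by fact
    \<comment> \<open>Tightness is stated with intervals open on the left, so the left end has to
      lie below 0.\<close>
    show "(-1::real) < 1" by simp
    fix \<epsilon> :: real and n assume "\<epsilon> > 0"
    have "measure (M n) {-1<..1} = measure (\<mu> n) (e -` {-1<..1} \<inter> space (\<mu> n))"
      unfolding M_def by (rule measure_distr[OF e_\<mu>]) simp
    also have "e -` {-1<..1} \<inter> space (\<mu> n) = space (\<mu> n)"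
      using K by fastforce
    finally show "measure (M n) {-1<..1} > 1 - \<epsilon>"
      using prob_space.prob_space[OF \<mu>(1)] \<open>\<epsilon> > 0\<close> by simp
  qed
  then obtain r N where r: "strict_mono r" and N: "real_distribution N" and conv: "weak_conv_m (M \<circ> id \<circ> r) N"
    using tight_imp_convergent_subsubsequence[of M id] by (auto simp: strict_mono_id)
  interpret N: real_distribution N by fact
  have lim: "(\<lambda>n. \<integral>x. h (e x) \<partial>\<mu> (r n)) \<longlonglongrightarrow> (\<integral>u. h u \<partial>N)"
    if h: "continuous_on UNIV h" "\<And>u. \<bar>h u\<bar> \<le> B" for h :: "real \<Rightarrow> real" and B
  proof -
    have "(\<lambda>n. \<integral>u. h u \<partial>(M \<circ> id \<circ> r) n) \<longlonglongrightarrow> (\<integral>u. h u \<partial>N)"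
      using h M_rd N conv
      by (intro weak_conv_imp_integral_bdd_continuous_conv[of _ _ _ B])
         (auto simp: continuous_on_eq_continuous_at comp_def)
    moreover have "(\<integral>u. h u \<partial>(M \<circ> id \<circ> r) n) = (\<integral>x. h (e x) \<partial>\<mu> (r n))" for n
      unfolding M_def using borel_measurable_continuous_onI[OF h(1)] e_\<mu>
      by (simp add: integral_distr)
    ultimately show ?thesis by simp
  qed
  have "K \<noteq> {}"
    using K(3) by auto
  \<comment> \<open>A bounded continuous function with zero set \<open>K\<close>. Its integrals
    against the images of the measures vanish, hence so does its integral against the limit, which
    is thus carried by \<open>K\<close>.\<close>
  define q where "q u = min 1 (infdist u K)" for u
  have q: "continuous_on UNIV q" "\<And>u. \<bar>q u\<bar> \<le> 1" "\<And>u. q u \<ge> 0"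
    by (auto simp: q_def infdist_nonneg intro!: continuous_intros)
  have "q (e x) = 0" for x
    using subsetD[OF K(3) rangeI, of x] by (simp add: q_def)
  then have "(\<integral>u. q u \<partial>N) = 0"
    using lim[OF q(1,2)] LIMSEQ_unique[OF _ tendsto_const] by fastforce
  moreover have "integrable N q"
    using q borel_measurable_continuous_onI[OF q(1)] by (intro N.integrable_const_bound[of _ 1]) auto
  ultimately have "AE u in N. q u = 0"
    using integral_nonneg_eq_0_iff_AE[of N q] q(3) by simp
  then have AE_K: "AE u in N. u \<in> K"
    by eventually_elim
      (use K \<open>K \<noteq> {}\<close> in \<open>auto simp: q_def min_def in_closed_iff_infdist_zero split: if_splits\<close>)
  \<comment> \<open>Nothing is known about \<open>\<pi>\<close> off \<open>K\<close>; a constant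
    value on that null set makes the map Borel.\<close>
  define \<pi>' where "\<pi>' u = (if u \<in> K then \<pi> u else undefined)" for u
  have \<pi>'_meas: "\<pi>' \<in> measurable N borel"
  proof -
    have "\<pi>' \<in> borel_measurable borel"
      unfolding \<pi>'_def using borel_measurable_continuous_on_restrict[OF \<pi>(1)] K(1)
      by (subst measurable_If_restrict_space_iff) auto
    then show ?thesis
      using measurable_cong_sets[OF N.events_eq_borel refl] by blast
  qed
  define \<nu> where "\<nu> = distr N borel \<pi>'"
  have "(\<lambda>n. \<integral>x. h x \<partial>\<mu> (r n)) \<longlonglongrightarrow> (\<integral>x. h x \<partial>\<nu>)"
    if h: "continuous_on UNIV h" for h :: "'a \<Rightarrow> real"
  proof -
    obtain C where C: "C > 0" "\<And>x. \<bar>h x\<bar> \<le> C"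
      using compact_continuous_bounded[OF cpt h] by metis
    have "continuous_on K (\<lambda>u. h (\<pi> u))"
      by (rule continuous_on_compose2[OF h \<pi>(1)]) simp
    moreover have "closedin (top_of_set UNIV) K"
      using K(1) by simp
    ultimately obtain H where "continuous_on UNIV H" "\<And>u. u \<in> K \<Longrightarrow> H u = h (\<pi> u)"
        "\<And>u. u \<in> UNIV \<Longrightarrow> norm (H u) \<le> C"
      by (rule Tietze[where B = C]) (use C in \<open>auto intro: less_imp_le\<close>)
    then have H: "continuous_on UNIV H" "\<And>u. u \<in> K \<Longrightarrow> H u = h (\<pi> u)" "\<And>u. \<bar>H u\<bar> \<le> C"
      by auto
    have "(\<integral>x. h x \<partial>\<nu>) = (\<integral>u. h (\<pi>' u) \<partial>N)"
      unfolding \<nu>_def using borel_measurable_continuous_onI[OF h] \<pi>'_meas by (simp add: integral_distr)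
    also have "\<dots> = (\<integral>u. H u \<partial>N)"
    proof (rule integral_cong_AE)
      show "(\<lambda>u. h (\<pi>' u)) \<in> borel_measurable N"
        using borel_measurable_continuous_onI[OF h] \<pi>'_meas by measurable
      show "H \<in> borel_measurable N"
        using borel_measurable_continuous_onI[OF H(1)] by simp
      show "AE u in N. h (\<pi>' u) = H u"
        using AE_K by eventually_elim (auto simp: \<pi>'_def H)
    qed
    finally have "(\<integral>x. h x \<partial>\<nu>) = (\<integral>u. H u \<partial>N)" .
    moreover have "H (e x) = h x" for x
      using H(2)[of "e x"] \<pi>(2) K(3) by auto
    ultimately show ?thesis
      using lim[OF H(1,3)] by simp
  qed
  moreover have "prob_space \<nu>"
    unfolding \<nu>_def using \<pi>'_meas by (rule N.prob_space_distr)
  moreover have "sets \<nu> = sets borel"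
    by (simp add: \<nu>_def)
  ultimately show thesis
    using that r by blast
qed

text \<open>The functions \<open>min 1 (n * \<Sum>k\<in>S. t k x)\<close> increase with \<open>n\<close> to indicators of a base of open sets
  closed under finite unions.\<close>
lemma countable_separating_functions:
  assumes cpt: "compact (UNIV :: 'a::metric_space set)"
  obtains u :: "nat \<Rightarrow> 'a::metric_space \<Rightarrow> real" where
    "\<And>i. continuous_on UNIV (u i)" "\<And>i x. 0 \<le> u i x" "\<And>i x. u i x \<le> 1"
    "\<And>\<mu> \<nu>. \<lbrakk>prob_space \<mu>; prob_space \<nu>; sets \<mu> = sets borel; sets \<nu> = sets borel;
        \<And>i. (\<integral>x. u i x \<partial>\<mu>) = (\<integral>x. u i x \<partial>\<nu>)\<rbrakk> \<Longrightarrow> \<mu> = \<nu>"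
proof -
  obtain t :: "nat \<Rightarrow> 'a \<Rightarrow> real" where
    t: "\<And>k. continuous_on UNIV (t k)" "\<And>k x. t k x \<ge> 0"
    "\<And>\<epsilon>. \<epsilon> > 0 \<Longrightarrow> \<exists>N. \<forall>x. \<exists>k<N. t k x > 0 \<and> (\<forall>y. t k y > 0 \<longrightarrow> dist x y < \<epsilon>)"
    using compact_countable_tents[OF cpt] by metis
  define v where "v S n x = min 1 (real n * (\<Sum>k\<in>S. t k x))" for S n x
  \<comment> \<open>One index codes a finite set of tents together with a slope.\<close>
  define u where "u i = v (set_decode (fst (prod_decode i))) (snd (prod_decode i))" for i
  have v: "continuous_on UNIV (v S n)" "0 \<le> v S n x" "v S n x \<le> 1" for S n x
    unfolding v_def using t by (auto intro!: continuous_intros sum_nonneg mult_nonneg_nonneg)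
  have u_v: "v S n = u (prod_encode (set_encode S, n))" if "finite S" for S n
    using that by (simp add: u_def)
  show thesis
  proof
    show "continuous_on UNIV (u i)" "0 \<le> u i x" "u i x \<le> 1" for i x
      unfolding u_def by (rule v)+
    fix \<mu> \<nu> :: "'a measure"
    assume \<mu>: "prob_space \<mu>" and \<nu>: "prob_space \<nu>" and s\<mu>: "sets \<mu> = sets borel" and s\<nu>: "sets \<nu> = sets borel"
      and eq: "\<And>i. (\<integral>x. u i x \<partial>\<mu>) = (\<integral>x. u i x \<partial>\<nu>)"
    define W where "W S = {x. \<exists>k\<in>S. t k x > 0}" for S
    have W_open: "open (W S)" for S
    proof -
      have "open {x. t k x > 0}" for k
        using t(1) by (intro open_Collect_less) (auto intro!: continuous_intros)
      moreover have "W S = (\<Union>k\<in>S. {x. t k x > 0})"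
        by (auto simp: W_def)
      ultimately show ?thesis by auto
    qed
    have lim: "(\<lambda>n. \<integral>x. v S n x \<partial>M) \<longlonglongrightarrow> measure M (W S)"
      if S: "finite S" and M: "prob_space M" "sets M = sets borel" for S M
    proof -
      interpret M: prob_space M by fact
      have sp: "space M = UNIV"
        using sets_eq_imp_space_eq[OF M(2)] by simp
      have W_M: "W S \<in> sets M"
        using W_open M(2) by simp
      have "(\<lambda>n. v S n x) \<longlonglongrightarrow> indicator (W S) x" for x
      proof (cases "x \<in> W S")
        case True
        then obtain k where "k \<in> S" "t k x > 0"
          by (auto simp: W_def)
        then have pos: "(\<Sum>k\<in>S. t k x) > 0"
          using S t(2) by (intro sum_pos2) auto
        then have "\<forall>\<^sub>F n in sequentially. real n > 1 / (\<Sum>k\<in>S. t k x)"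
          by (intro eventually_gt_at_top filterlim_at_top_dense[THEN iffD1, rule_format] filterlim_real_sequentially)
        then have "\<forall>\<^sub>F n in sequentially. v S n x = 1"
          by eventually_elim (use pos in \<open>auto simp: v_def field_simps min_def\<close>)
        then show ?thesis
          using True by (simp add: tendsto_eventually)
      next
        case False
        then have "t k x = 0" if "k \<in> S" for k
          using that t(2)[of k x] by (auto simp: W_def less_le)
        then show ?thesis
          using False by (simp add: v_def)
      qed
      moreover have "v S n \<in> borel_measurable M" for n
        using borel_measurable_continuous_onI[OF v(1)] measurable_cong_sets[OF M(2) refl] by blast
      ultimately have "(\<lambda>n. \<integral>x. v S n x \<partial>M) \<longlonglongrightarrow> (\<integral>x. indicator (W S) x \<partial>M)"
        using v W_M by (intro integral_dominated_convergence[where w = "\<lambda>_. 1"]) auto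
      then show ?thesis
        using sp W_M by simp
    qed
    have W_eq: "measure \<mu> (W S) = measure \<nu> (W S)" if "finite S" for S
      using lim[OF that \<mu> s\<mu>] lim[OF that \<nu> s\<nu>] by (auto simp: eq u_v[OF that] intro: LIMSEQ_unique)
    have open_eq: "measure \<mu> U = measure \<nu> U" if U: "open U" for U
    proof -
      \<comment> \<open>All tents supported in \<open>U\<close>. Their supports cover
        \<open>U\<close>, and the finite subfamilies exhaust it increasingly; this is why
        \<open>v\<close> uses sums of tents and not single ones.\<close>
      define I where "I = {k. {x. t k x > 0} \<subseteq> U}"
      have "U \<subseteq> W I"
      proof
        fix x assume "x \<in> U"
        then obtain \<epsilon> where \<epsilon>: "\<epsilon> > 0" "ball x \<epsilon> \<subseteq> U"
          using U open_contains_ball by blast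
        obtain N where "\<forall>x. \<exists>k<N. t k x > 0 \<and> (\<forall>y. t k y > 0 \<longrightarrow> dist x y < \<epsilon>)"
          using t(3)[OF \<epsilon>(1)] by blast
        then obtain k where "t k x > 0" "\<And>y. t k y > 0 \<Longrightarrow> dist x y < \<epsilon>"
          by blast
        then show "x \<in> W I"
          using \<epsilon>(2) unfolding W_def I_def by (auto intro!: exI[of _ k])
      qed
      moreover have "W I = (\<Union>n. W (I \<inter> {..<n}))"
        unfolding W_def by auto
      moreover have "W I \<subseteq> U"
        unfolding W_def I_def by auto
      ultimately have UW: "U = (\<Union>n. W (I \<inter> {..<n}))"
        by simp
      have inc: "incseq (\<lambda>n. W (I \<inter> {..<n}))"
        by (force simp: incseq_def W_def)
      have "(\<lambda>n. measure M (W (I \<inter> {..<n}))) \<longlonglongrightarrow> measure M U" if M: "prob_space M" "sets M = sets borel" for M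
      proof -
        interpret M: prob_space M by fact
        show ?thesis
          unfolding UW using W_open M(2) inc by (intro M.finite_Lim_measure_incseq) auto
      qed
      from this[OF \<mu> s\<mu>] this[OF \<nu> s\<nu>] show ?thesis
        using W_eq by (auto intro: LIMSEQ_unique)
    qed
    interpret \<mu>: prob_space \<mu> by fact
    interpret \<nu>: prob_space \<nu> by fact
    show "\<mu> = \<nu>"
    proof (rule measure_eqI_generator_eq[where E = "{U. open U}" and \<Omega> = UNIV and A = "\<lambda>_. UNIV"])
      show "Int_stable {U. open (U :: 'a set)}"
        by (auto simp: Int_stable_def)
      show "emeasure \<mu> U = emeasure \<nu> U" if "U \<in> {U. open U}" for U
        using open_eq that by (simp add: \<mu>.emeasure_eq_measure \<nu>.emeasure_eq_measure)
    qed (auto simp: s\<mu> s\<nu> sets_borel)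
  qed
qed

lemma prob_measure_eqI_continuous:
  fixes \<mu> \<nu> :: "'a::metric_space measure"
  assumes "compact (UNIV :: 'a set)" "prob_space \<mu>" "prob_space \<nu>" "sets \<mu> = sets borel" "sets \<nu> = sets borel"
    and "\<And>h :: 'a \<Rightarrow> real. continuous_on UNIV h \<Longrightarrow> (\<integral>x. h x \<partial>\<mu>) = (\<integral>x. h x \<partial>\<nu>)"
  shows "\<mu> = \<nu>"
  using countable_separating_functions[OF assms(1)] assms by metis

section \<open>Invariant and ergodic measures\<close>

lemma invariant_measuresD:
  assumes "\<mu> \<in> invariant_measures T"
  shows "prob_space \<mu>" "sets \<mu> = sets borel" "space \<mu> = UNIV" "T \<in> measurable \<mu> \<mu>"
    "distr \<mu> \<mu> T = \<mu>"
proof -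
  show 1: "prob_space \<mu>" "sets \<mu> = sets borel" "T \<in> measurable \<mu> \<mu>"
    using assms by (auto simp: invariant_measures_def)
  show "space \<mu> = UNIV"
    using sets_eq_imp_space_eq[OF 1(2)] by simp
  show "distr \<mu> \<mu> T = \<mu>"
    using assms 1 by (intro measure_eqI) (auto simp: emeasure_distr invariant_measures_def)
qed

lemma invariant_integral_comp:
  fixes h :: "'a::metric_space \<Rightarrow> real"
  assumes "\<mu> \<in> invariant_measures T" "continuous_on UNIV h"
  shows "(\<integral>x. h (T x) \<partial>\<mu>) = (\<integral>x. h x \<partial>\<mu>)"
proof -
  note \<mu> = invariant_measuresD[OF assms(1)]
  have "h \<in> borel_measurable \<mu>"
    using borel_measurable_continuous_onI[OF assms(2)] measurable_cong_sets[OF \<mu>(2) refl] by blast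
  then have "(\<integral>x. h x \<partial>distr \<mu> \<mu> T) = (\<integral>x. h (T x) \<partial>\<mu>)"
    using \<mu>(4) by (simp add: integral_distr)
  then show ?thesis
    using \<mu>(5) by simp
qed

text \<open>The image measure under \<open>T\<close> has the same integrals of continuous functions,
  and these determine a Borel probability measure. Invariance thereby becomes a condition that
  survives weak limits.\<close>

lemma invariant_measuresI:
  fixes T :: "'a::metric_space \<Rightarrow> 'a"
  assumes cpt: "compact (UNIV :: 'a set)" and T: "continuous_on UNIV T"
    and \<mu>: "prob_space \<mu>" "sets \<mu> = sets borel"
    and inv: "\<And>h :: 'a \<Rightarrow> real. continuous_on UNIV h \<Longrightarrow> (\<integral>x. h (T x) \<partial>\<mu>) = (\<integral>x. h x \<partial>\<mu>)"
  shows "\<mu> \<in> invariant_measures T"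
proof -
  have T_borel: "T \<in> measurable \<mu> borel"
    using borel_measurable_continuous_onI[OF T] measurable_cong_sets[OF \<mu>(2) refl] by blast
  have "distr \<mu> borel T = \<mu>"
  proof (rule prob_measure_eqI_continuous[OF cpt])
    show "prob_space (distr \<mu> borel T)"
      using prob_space.prob_space_distr[OF \<mu>(1) T_borel] .
    show "(\<integral>x. h x \<partial>distr \<mu> borel T) = (\<integral>x. h x \<partial>\<mu>)" if "continuous_on UNIV h" for h :: "'a \<Rightarrow> real"
      using inv[OF that] borel_measurable_continuous_onI[OF that] T_borel by (simp add: integral_distr)
  qed (use \<mu> in auto)
  then have "emeasure \<mu> (T -` A \<inter> space \<mu>) = emeasure \<mu> A" if "A \<in> sets \<mu>" for A
    using emeasure_distr[OF T_borel, of A] that \<mu>(2) by simp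
  moreover have "T \<in> measurable \<mu> \<mu>"
    using T_borel measurable_cong_sets[OF refl \<mu>(2)] by blast
  ultimately show ?thesis
    using \<mu> by (simp add: invariant_measures_def)
qed

lemma invariant_measures_weak_limit:
  fixes T :: "'a::metric_space \<Rightarrow> 'a"
  assumes cpt: "compact (UNIV :: 'a set)" and T: "continuous_on UNIV T"
    and \<mu>: "\<And>n. \<mu> n \<in> invariant_measures T" and \<nu>: "prob_space \<nu>" "sets \<nu> = sets borel"
    and lim: "\<And>h :: 'a \<Rightarrow> real. continuous_on UNIV h \<Longrightarrow> (\<lambda>n. \<integral>x. h x \<partial>\<mu> n) \<longlonglongrightarrow> (\<integral>x. h x \<partial>\<nu>)"
  shows "\<nu> \<in> invariant_measures T"
proof (rule invariant_measuresI[OF cpt T \<nu>])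
  fix h :: "'a \<Rightarrow> real" assume h: "continuous_on UNIV h"
  have "continuous_on UNIV (\<lambda>x. h (T x))"
    by (rule continuous_on_compose2[OF h T]) simp
  then show "(\<integral>x. h (T x) \<partial>\<nu>) = (\<integral>x. h x \<partial>\<nu>)"
    using lim[of "\<lambda>x. h (T x)"] lim[OF h] invariant_integral_comp[OF \<mu> h]
    by (auto intro: LIMSEQ_unique)
qed

lemma integral_uniform_measure:
  fixes h :: "'a \<Rightarrow> real"
  assumes "finite_measure M" "A \<in> sets M" "measure M A > 0" "h \<in> borel_measurable M"
  shows "(\<integral>x. h x \<partial>uniform_measure M A) = (\<integral>x. indicator A x * h x \<partial>M) / measure M A"
proof -
  interpret finite_measure M by fact
  have "uniform_measure M A = density M (\<lambda>x. ennreal (indicator A x / measure M A))"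
    unfolding uniform_measure_def emeasure_eq_measure using assms(2,3)
    by (intro density_cong borel_measurable_divide borel_measurable_divide_ennreal measurable_compose[OF _ measurable_ennreal])
       (auto simp: indicator_def divide_ennreal[of 1, simplified] split: if_splits)
  then show ?thesis
    using assms by (simp add: integral_density)
qed

text \<open>For an invariant \<open>A\<close>, intersecting with \<open>A\<close> commutes with
  taking preimages under \<open>T\<close>. A failure of ergodicity thus splits a measure into two
  invariant ones.\<close>

lemma invariant_uniform_measure:
  assumes \<mu>: "\<mu> \<in> invariant_measures T" and A: "A \<in> sets borel" "T -` A = A" "measure \<mu> A > 0"
  shows "uniform_measure \<mu> A \<in> invariant_measures T"
proof -
  note \<mu>' = invariant_measuresD[OF \<mu>]
  interpret prob_space \<mu> by (rule \<mu>'(1))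
  have A': "A \<in> sets \<mu>"
    using A \<mu>' by simp
  have "emeasure (uniform_measure \<mu> A) (T -` B \<inter> space \<mu>) = emeasure (uniform_measure \<mu> A) B"
    if B: "B \<in> sets \<mu>" for B
  proof -
    have "T -` B \<in> sets \<mu>"
      using measurable_sets[OF \<mu>'(4) B] \<mu>'(3) by simp
    moreover have "A \<inter> T -` B = T -` (A \<inter> B) \<inter> space \<mu>"
      using A(2) \<mu>'(3) by auto
    moreover have "emeasure \<mu> (T -` (A \<inter> B) \<inter> space \<mu>) = emeasure \<mu> (A \<inter> B)"
      using \<mu> A' B unfolding invariant_measures_def by blast
    ultimately show ?thesis
      using A' B \<mu>'(3) by simp
  qed
  moreover have "prob_space (uniform_measure \<mu> A)"
    using A(3) by (intro prob_space_uniform_measure) (auto simp: emeasure_eq_measure)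
  moreover have "T \<in> measurable (uniform_measure \<mu> A) (uniform_measure \<mu> A)"
    using \<mu>'(4) by (simp add: measurable_def)
  ultimately show ?thesis
    using \<mu>' by (simp add: invariant_measures_def)
qed

text \<open>A small strictly convex perturbation of \<open>\<nu> \<mapsto> \<integral>h d\<nu>\<close> attains its maximum over the
  invariant measures at an extreme point, that is, at an ergodic measure.\<close>
theorem ergodic_measure_almost_maximal:
  fixes T :: "'a::metric_space \<Rightarrow> 'a" and h :: "'a \<Rightarrow> real"
  assumes cpt: "compact (UNIV :: 'a set)" and T: "continuous_on UNIV T"
    and \<mu>: "\<mu> \<in> invariant_measures T" and h: "continuous_on UNIV h" and "\<delta> > 0"
  obtains \<nu> where "\<nu> \<in> ergodic_measures T" "(\<integral>x. h x \<partial>\<nu>) \<ge> (\<integral>x. h x \<partial>\<mu>) - \<delta>"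
proof -
  obtain u :: "nat \<Rightarrow> 'a \<Rightarrow> real" where
    u: "\<And>i. continuous_on UNIV (u i)" "\<And>i x. 0 \<le> u i x" "\<And>i x. u i x \<le> 1"
    and sep: "\<And>\<mu> \<nu>. \<lbrakk>prob_space \<mu>; prob_space \<nu>; sets \<mu> = sets borel; sets \<nu> = sets borel;
        \<And>i. (\<integral>x. u i x \<partial>\<mu>) = (\<integral>x. u i x \<partial>\<nu>)\<rbrakk> \<Longrightarrow> \<mu> = \<nu>"
    using countable_separating_functions[OF cpt] by metis
  \<comment> \<open>A square of a linear functional is convex; summing over a separating family
    makes the convexity strict. The weights make \<open>J\<close> lie between 0 and 2, so the
    perturbation in \<open>G\<close> lies between 0 and \<delta>, which is the loss allowed in the
    conclusion.\<close>
  define j where "j \<nu> i = (1/2) ^ i * (\<integral>x. u i x \<partial>\<nu>)\<^sup>2" for \<nu> i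
  define J where "J \<nu> = (\<Sum>i. j \<nu> i)" for \<nu>
  define G where "G \<nu> = (\<integral>x. h x \<partial>\<nu>) + \<delta> / 2 * J \<nu>" for \<nu>
  have u01: "0 \<le> (\<integral>x. u i x \<partial>\<nu>)" "(\<integral>x. u i x \<partial>\<nu>) \<le> 1"
    if "prob_space \<nu>" "sets \<nu> = sets borel" for \<nu> i
  proof -
    interpret prob_space \<nu> by fact
    have "integrable \<nu> (u i)"
      using that by (intro continuous_integrable[OF cpt u(1)]) unfold_locales
    then show "0 \<le> (\<integral>x. u i x \<partial>\<nu>)" "(\<integral>x. u i x \<partial>\<nu>) \<le> 1"
      using u by (auto intro!: integral_le_const)
  qed
  have j_bound: "\<bar>j \<nu> i\<bar> \<le> (1/2) ^ i" "0 \<le> j \<nu> i"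
    if "prob_space \<nu>" "sets \<nu> = sets borel" for \<nu> i
    using u01[OF that, of i] by (auto simp: j_def abs_mult power_le_one)
  have gs: "summable (\<lambda>i. (1/2::real) ^ i)"
    by (simp add: summable_geometric)
  have j_summable: "summable (j \<nu>)" if "prob_space \<nu>" "sets \<nu> = sets borel" for \<nu>
    using j_bound(1)[OF that] by (intro summable_comparison_test'[OF gs]) auto
  have J: "0 \<le> J \<nu>" "J \<nu> \<le> 2" if "prob_space \<nu>" "sets \<nu> = sets borel" for \<nu>
  proof -
    show "0 \<le> J \<nu>"
      unfolding J_def using j_bound(2)[OF that] j_summable[OF that] by (intro suminf_nonneg)
    have "J \<nu> \<le> (\<Sum>i. (1/2) ^ i)"
      unfolding J_def using j_bound(1)[OF that] j_summable[OF that] gs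
      by (intro suminf_le) (auto dest: abs_le_D1)
    then show "J \<nu> \<le> 2"
      by (simp add: suminf_geometric)
  qed
  obtain C where C: "\<And>x. \<bar>h x\<bar> \<le> C"
    using compact_continuous_bounded[OF cpt h] by metis
  have G_bound: "G \<nu> \<le> C + \<delta>" if "\<nu> \<in> invariant_measures T" for \<nu>
  proof -
    note \<nu> = invariant_measuresD(1,2)[OF that]
    interpret prob_space \<nu> by (rule \<nu>)
    have "(\<integral>x. h x \<partial>\<nu>) \<le> C"
      using \<nu>(2) C by (intro integral_le_const continuous_integrable[OF cpt h]) (auto dest: abs_le_D1, unfold_locales)
    moreover have "\<delta> / 2 * J \<nu> \<le> \<delta> / 2 * 2"
      using J(2)[OF \<nu>] \<open>\<delta> > 0\<close> by (intro mult_left_mono) auto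
    ultimately show ?thesis
      by (simp add: G_def)
  qed
  have bdd: "bdd_above (G ` invariant_measures T)"
    using G_bound by (intro bdd_aboveI2)
  have ne: "G ` invariant_measures T \<noteq> {}"
    using \<mu> by auto
  have "\<exists>v. (\<forall>n. v n \<in> G ` invariant_measures T) \<and> v \<longlonglongrightarrow> Sup (G ` invariant_measures T)"
    using closure_contains_Sup[OF ne bdd] unfolding closure_sequential .
  then obtain v where v: "\<forall>n. \<exists>\<mu>\<in>invariant_measures T. v n = G \<mu>" "v \<longlonglongrightarrow> Sup (G ` invariant_measures T)"
    unfolding image_iff by metis
  obtain \<mu>s where "\<And>n. \<mu>s n \<in> invariant_measures T" "v = (\<lambda>n. G (\<mu>s n))"
    using choice[OF v(1)[unfolded Bex_def]] by auto
  with v(2) have \<mu>s: "\<And>n. \<mu>s n \<in> invariant_measures T" "(\<lambda>n. G (\<mu>s n)) \<longlonglongrightarrow> Sup (G ` invariant_measures T)"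
    by simp_all
  obtain r \<nu> where r: "strict_mono r" and \<nu>: "prob_space \<nu>" "sets \<nu> = sets borel"
    and lim: "\<And>h :: 'a \<Rightarrow> real. continuous_on UNIV h \<Longrightarrow> (\<lambda>n. \<integral>x. h x \<partial>\<mu>s (r n)) \<longlonglongrightarrow> (\<integral>x. h x \<partial>\<nu>)"
    using prob_measures_weak_seq_compact[of \<mu>s, OF cpt invariant_measuresD(1,2)[OF \<mu>s(1)]] by blast
  have \<nu>_inv: "\<nu> \<in> invariant_measures T"
    using \<mu>s(1) lim by (intro invariant_measures_weak_limit[OF cpt T _ \<nu>, of "\<lambda>n. \<mu>s (r n)"])
  \<comment> \<open>Continuity of \<open>J\<close> along the sequence: each term converges because
    \<open>u i\<close> is continuous, and \<open>(1/2) ^ i\<close> dominates for all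
    \<open>n\<close>.\<close>
  have "(\<lambda>n. \<Sum>i. j (\<mu>s (r n)) i) \<longlonglongrightarrow> (\<Sum>i. j \<nu> i)"
  proof (rule conjunct2[OF conjunct2[OF tannerys_theorem]])
    show "(\<lambda>n. j (\<mu>s (r n)) i) \<longlonglongrightarrow> j \<nu> i" for i
      unfolding j_def using lim[OF u(1)] by (intro tendsto_intros)
    show "\<forall>\<^sub>F (i, n) in at_top \<times>\<^sub>F sequentially. norm (j (\<mu>s (r n)) i) \<le> (1/2) ^ i"
      using j_bound(1)[OF invariant_measuresD(1,2)[OF \<mu>s(1)]] by (intro always_eventually) auto
  qed (use gs in auto)
  then have "(\<lambda>n. G (\<mu>s (r n))) \<longlonglongrightarrow> G \<nu>"
    unfolding G_def J_def using lim[OF h] by (intro tendsto_intros)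
  moreover have "(\<lambda>n. G (\<mu>s (r n))) \<longlonglongrightarrow> Sup (G ` invariant_measures T)"
    using LIMSEQ_subseq_LIMSEQ[OF \<mu>s(2) r] by (simp add: o_def)
  ultimately have "G \<nu> = Sup (G ` invariant_measures T)"
    by (rule LIMSEQ_unique)
  then have max: "G \<nu>' \<le> G \<nu>" if "\<nu>' \<in> invariant_measures T" for \<nu>'
    using cSup_upper[OF _ bdd, of "G \<nu>'"] that by simp
  interpret \<nu>: prob_space \<nu> by (rule \<nu>)
  have "measure \<nu> A = 0 \<or> measure \<nu> A = 1" if A: "A \<in> sets borel" "T -` A = A" for A
  proof (rule ccontr)
    assume "\<not> (measure \<nu> A = 0 \<or> measure \<nu> A = 1)"
    moreover define \<alpha> where "\<alpha> = measure \<nu> A"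
    ultimately have \<alpha>: "0 < \<alpha>" "\<alpha> < 1"
      by (auto simp: less_le)
    have A': "A \<in> sets \<nu>" "- A \<in> sets \<nu>"
      using A \<nu>(2) by auto
    have compl: "measure \<nu> (- A) = 1 - \<alpha>"
      using \<nu>.prob_compl[OF A'(1)] invariant_measuresD(3)[OF \<nu>_inv] by (simp add: \<alpha>_def Compl_eq_Diff_UNIV)
    define \<nu>1 where "\<nu>1 = uniform_measure \<nu> A"
    define \<nu>2 where "\<nu>2 = uniform_measure \<nu> (- A)"
    have inv1: "\<nu>1 \<in> invariant_measures T"
      unfolding \<nu>1_def using \<alpha> A by (intro invariant_uniform_measure[OF \<nu>_inv]) (auto simp: \<alpha>_def)
    have inv2: "\<nu>2 \<in> invariant_measures T"
      unfolding \<nu>2_def using \<alpha> A by (intro invariant_uniform_measure[OF \<nu>_inv]) (auto simp: compl)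
    note \<nu>1 = invariant_measuresD(1,2)[OF inv1] and \<nu>2 = invariant_measuresD(1,2)[OF inv2]
    have split: "(\<integral>x. k x \<partial>\<nu>) = \<alpha> * (\<integral>x. k x \<partial>\<nu>1) + (1 - \<alpha>) * (\<integral>x. k x \<partial>\<nu>2)"
      if k: "continuous_on UNIV k" for k :: "'a \<Rightarrow> real"
    proof -
      have int: "integrable \<nu> k"
        using \<nu>(2) by (intro continuous_integrable[OF cpt k]) unfold_locales
      have "(\<integral>x. k x \<partial>\<nu>) = (\<integral>x. indicator A x * k x + indicator (- A) x * k x \<partial>\<nu>)"
        by (intro Bochner_Integration.integral_cong) (auto simp: indicator_def)
      also have "\<dots> = (\<integral>x. indicator A x * k x \<partial>\<nu>) + (\<integral>x. indicator (- A) x * k x \<partial>\<nu>)"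
        using A' int by (intro Bochner_Integration.integral_add integrable_real_mult_indicator[unfolded mult.commute[of _ "indicator _ _"]]) auto
      finally show ?thesis
        using \<alpha> A' compl integral_uniform_measure[of \<nu> A k] integral_uniform_measure[of \<nu> "- A" k] int \<nu>.finite_measure_axioms
        by (simp add: \<nu>1_def \<nu>2_def \<alpha>_def)
    qed
    \<comment> \<open>The convexity defect, from \<open>(\<alpha> p + (1 - \<alpha>) q)\<^sup>2 =
      \<alpha> p\<^sup>2 + (1 - \<alpha>) q\<^sup>2 - \<alpha> (1 - \<alpha>) (p -
      q)\<^sup>2\<close>.\<close>
    define d where "d i = (1/2) ^ i * ((\<integral>x. u i x \<partial>\<nu>1) - (\<integral>x. u i x \<partial>\<nu>2))\<^sup>2" for i
    have j_d: "j \<nu> i = \<alpha> * j \<nu>1 i + (1 - \<alpha>) * j \<nu>2 i - \<alpha> * (1 - \<alpha>) * d i" for i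
      unfolding j_def d_def split[OF u(1)] by (simp add: power2_eq_square algebra_simps)
    have s_d: "summable d"
    proof -
      have "d = (\<lambda>i. (\<alpha> * j \<nu>1 i + (1 - \<alpha>) * j \<nu>2 i - j \<nu> i) / (\<alpha> * (1 - \<alpha>)))"
        using j_d \<alpha> by (auto simp: field_simps)
      moreover have "summable (\<lambda>i. (\<alpha> * j \<nu>1 i + (1 - \<alpha>) * j \<nu>2 i - j \<nu> i) / (\<alpha> * (1 - \<alpha>)))"
        by (intro summable_divide summable_diff summable_add summable_mult j_summable \<nu>1 \<nu>2 \<nu>)
      ultimately show ?thesis by simp
    qed
    have J_\<nu>: "J \<nu> = \<alpha> * J \<nu>1 + (1 - \<alpha>) * J \<nu>2 - \<alpha> * (1 - \<alpha>) * suminf d"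
      unfolding J_def using sums_diff[OF sums_add[OF sums_mult[OF summable_sums[OF j_summable[OF \<nu>1]], of \<alpha>]
        sums_mult[OF summable_sums[OF j_summable[OF \<nu>2]], of "1 - \<alpha>"]] sums_mult[OF summable_sums[OF s_d], of "\<alpha> * (1 - \<alpha>)"]]
      unfolding j_d[symmetric] by (simp add: sums_iff)
    have "G \<nu> = \<alpha> * G \<nu>1 + (1 - \<alpha>) * G \<nu>2 - \<delta> / 2 * (\<alpha> * (1 - \<alpha>) * suminf d)"
      unfolding G_def split[OF h] J_\<nu> by (simp add: field_simps)
    moreover have "\<alpha> * G \<nu>1 + (1 - \<alpha>) * G \<nu>2 \<le> G \<nu>"
      using convex_bound_le[OF max[OF inv1] max[OF inv2], of \<alpha> "1 - \<alpha>"] \<alpha> by simp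
    \<comment> \<open>A maximum leaves no room for a defect. So every \<open>d i\<close> vanishes
      and the two conditional measures agree on the separating family, although only one of them
      charges \<open>A\<close>.\<close>
    ultimately have "\<delta> / 2 * (\<alpha> * (1 - \<alpha>) * suminf d) \<le> 0"
      by simp
    moreover have "0 < \<delta> / 2 * (\<alpha> * (1 - \<alpha>))"
      using \<alpha> \<open>\<delta> > 0\<close> by simp
    ultimately have "suminf d \<le> 0"
      by (metis mult.assoc mult_pos_pos not_le)
    moreover have d_nonneg: "0 \<le> d i" for i
      by (simp add: d_def)
    ultimately have "suminf d = 0"
      using suminf_nonneg[OF s_d d_nonneg] by linarith
    then have "d i = 0" for i
      using suminf_eq_zero_iff[OF s_d d_nonneg] by simp
    then have "\<nu>1 = \<nu>2"
      by (intro sep \<nu>1 \<nu>2) (simp add: d_def)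
    moreover have "measure \<nu>1 A = 1" "measure \<nu>2 A = 0"
      unfolding \<nu>1_def \<nu>2_def using \<alpha> A' compl by (auto simp: \<alpha>_def \<nu>.emeasure_eq_measure)
    ultimately show False by simp
  qed
  then have "\<nu> \<in> ergodic_measures T"
    using \<nu>_inv by (simp add: ergodic_measures_def)
  moreover have "(\<integral>x. h x \<partial>\<mu>) - \<delta> \<le> (\<integral>x. h x \<partial>\<nu>)"
  proof -
    have "0 \<le> \<delta> / 2 * J \<mu>"
      using J(1)[OF invariant_measuresD(1,2)[OF \<mu>]] \<open>\<delta> > 0\<close> by simp
    moreover have "\<delta> / 2 * J \<nu> \<le> \<delta> / 2 * 2"
      using J(2)[OF \<nu>] \<open>\<delta> > 0\<close> by (intro mult_left_mono) auto
    ultimately show ?thesis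
      using max[OF \<mu>] by (simp add: G_def)
  qed
  ultimately show thesis
    by (rule that)
qed

section \<open>Asymptotically additive potentials\<close>

lemma continuous_on_funpow:
  fixes T :: "'a::topological_space \<Rightarrow> 'a"
  assumes "continuous_on UNIV T"
  shows "continuous_on UNIV (T ^^ n)"
proof (induction n)
  case (Suc n)
  then show ?case
    using continuous_on_compose2[OF assms Suc] by (simp add: comp_def)
qed (simp add: id_def)

lemma continuous_on_birkhoff_sum:
  fixes T :: "'a::topological_space \<Rightarrow> 'a"
  assumes "continuous_on UNIV T" "continuous_on UNIV h"
  shows "continuous_on UNIV (birkhoff_sum T n h)"
proof -
  have "continuous_on UNIV (\<lambda>x. h ((T ^^ i) x))" for i
    by (rule continuous_on_compose2[OF assms(2) continuous_on_funpow[OF assms(1)]]) simp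
  then show ?thesis
    unfolding birkhoff_sum_def[abs_def] by (intro continuous_on_sum)
qed

lemma birkhoff_sum_linear:
  "birkhoff_sum T n (\<lambda>x. a * h x + b * k x) x = a * birkhoff_sum T n h x + b * birkhoff_sum T n k x"
  by (simp add: birkhoff_sum_def sum.distrib sum_distrib_left)

lemma birkhoff_sum_bound:
  assumes "\<And>x. \<bar>h x\<bar> \<le> C"
  shows "\<bar>birkhoff_sum T n h x\<bar> \<le> C * real n"
proof -
  have "\<bar>birkhoff_sum T n h x\<bar> \<le> (\<Sum>i<n. \<bar>h ((T ^^ i) x)\<bar>)"
    unfolding birkhoff_sum_def by (rule sum_abs)
  also have "\<dots> \<le> (\<Sum>i<n. C)"
    by (intro sum_mono assms)
  finally show ?thesis
    by (simp add: mult.commute)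
qed

lemma birkhoff_sum_add:
  "birkhoff_sum T (a + n) h x = birkhoff_sum T a h x + birkhoff_sum T n h ((T ^^ a) x)"
proof (induction n)
  case (Suc n)
  have "(T ^^ (a + n)) x = (T ^^ n) ((T ^^ a) x)"
    by (simp add: funpow_add add.commute[of a n])
  then show ?case
    using Suc by (simp add: birkhoff_sum_def)
qed (simp add: birkhoff_sum_def)

lemma invariant_integral_birkhoff_sum:
  fixes T :: "'a::metric_space \<Rightarrow> 'a"
  assumes cpt: "compact (UNIV :: 'a set)" and T: "continuous_on UNIV T"
    and \<mu>: "\<mu> \<in> invariant_measures T" and h: "continuous_on UNIV h"
  shows "(\<integral>x. birkhoff_sum T n h x \<partial>\<mu>) = real n * (\<integral>x. h x \<partial>\<mu>)"
proof -
  note \<mu>' = invariant_measuresD[OF \<mu>]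
  interpret prob_space \<mu> by (rule \<mu>')
  have cont: "continuous_on UNIV (\<lambda>x. h ((T ^^ i) x))" for i
    by (rule continuous_on_compose2[OF h continuous_on_funpow[OF T]]) simp
  have "(\<integral>x. h ((T ^^ i) x) \<partial>\<mu>) = (\<integral>x. h x \<partial>\<mu>)" for i
  proof (induction i)
    case (Suc i)
    then show ?case
      using invariant_integral_comp[OF \<mu> cont[of i]] by (simp add: funpow_swap1)
  qed simp
  moreover have "integrable \<mu> (\<lambda>x. h ((T ^^ i) x))" for i
    using \<mu>'(2) by (intro continuous_integrable[OF cpt cont]) unfold_locales
  ultimately show ?thesis
    by (simp add: birkhoff_sum_def)
qed

text \<open>The working form of the definition, with a pointwise bound in place of a limsup of
  suprema. Compactness ensures that the real-valued \<open>SUP\<close> is that of a bounded set; in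
  the converse direction, passing through half of \<xi> restores the strict inequality.\<close>

lemma AAP_iff:
  fixes T :: "'a::metric_space \<Rightarrow> 'a"
  assumes cpt: "compact (UNIV :: 'a set)" and T: "continuous_on UNIV T"
  shows "AAP T f \<longleftrightarrow> (\<forall>n\<ge>1. continuous_on UNIV (f n)) \<and>
    (\<forall>\<xi>>0. \<exists>h. continuous_on UNIV h \<and>
       (\<forall>\<^sub>F n in sequentially. \<forall>x. \<bar>f n x - birkhoff_sum T n h x\<bar> \<le> \<xi> * real n))"
    (is "_ \<longleftrightarrow> ?C \<and> (\<forall>\<xi>>0. \<exists>h. _ \<and> ?E \<xi> h)")
proof -
  let ?L = "\<lambda>h. limsup (\<lambda>n. ereal ((SUP x. \<bar>f n x - birkhoff_sum T n h x\<bar>) / real n))"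
  have 1: "?E \<xi> h" if f: ?C and h: "continuous_on UNIV h" and L: "?L h < ereal \<xi>" for \<xi> h
    using Limsup_lessD[OF L] eventually_ge_at_top[of 1]
  proof eventually_elim
    case (elim n)
    have "continuous_on UNIV (\<lambda>x. f n x - birkhoff_sum T n h x)"
      using f elim continuous_on_birkhoff_sum[OF T h] by (intro continuous_on_diff) auto
    then obtain C where "\<And>x. \<bar>f n x - birkhoff_sum T n h x\<bar> \<le> C"
      using compact_continuous_bounded[OF cpt] by metis
    then have "bdd_above (range (\<lambda>x. \<bar>f n x - birkhoff_sum T n h x\<bar>))"
      by (rule bdd_aboveI2)
    then have "\<bar>f n x - birkhoff_sum T n h x\<bar> \<le> (SUP x. \<bar>f n x - birkhoff_sum T n h x\<bar>)" for x
      by (rule cSUP_upper[OF UNIV_I])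
    also have "(SUP x. \<bar>f n x - birkhoff_sum T n h x\<bar>) \<le> \<xi> * real n"
      using elim by (simp add: field_simps)
    finally show ?case
      by simp
  qed
  have 2: "?L h < ereal \<xi>" if "?E (\<xi> / 2) h" "\<xi> > 0" for \<xi> h
  proof -
    have "?L h \<le> ereal (\<xi> / 2)"
    proof (rule Limsup_bounded)
      show "\<forall>\<^sub>F n in sequentially. ereal ((SUP x. \<bar>f n x - birkhoff_sum T n h x\<bar>) / real n) \<le> ereal (\<xi> / 2)"
        using that(1) eventually_ge_at_top[of 1]
      proof eventually_elim
        case (elim n)
        then have "(SUP x. \<bar>f n x - birkhoff_sum T n h x\<bar>) \<le> \<xi> / 2 * real n"
          by (intro cSUP_least) auto
        then show ?case
          using elim by (simp add: field_simps)
      qed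
    qed
    also have "ereal (\<xi> / 2) < ereal \<xi>"
      using that by simp
    finally show ?thesis .
  qed
  show ?thesis
    unfolding AAP_def using 1 2 by (meson half_gt_zero)
qed

lemma AAP_continuous: "AAP T f \<Longrightarrow> n \<ge> 1 \<Longrightarrow> continuous_on UNIV (f n)"
  by (simp add: AAP_def)

text \<open>This makes ratios accessible to linear arguments: \<open>f n / g n\<close> is compared
  with a number \<open>c\<close> through the sign of the potential
  \<open>f n - c * g n\<close>.\<close>

lemma AAP_linear:
  fixes T :: "'a::metric_space \<Rightarrow> 'a"
  assumes cpt: "compact (UNIV :: 'a set)" and T: "continuous_on UNIV T" and f: "AAP T f" and g: "AAP T g"
  shows "AAP T (\<lambda>n x. a * f n x + b * g n x)"
  unfolding AAP_iff[OF cpt T]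
proof (intro conjI allI impI)
  show "continuous_on UNIV (\<lambda>x. a * f n x + b * g n x)" if "1 \<le> n" for n
    using AAP_continuous[OF f that] AAP_continuous[OF g that] by (intro continuous_intros)
  fix \<xi> :: real assume "\<xi> > 0"
  \<comment> \<open>The summand 1 keeps the denominator positive when both coefficients
    vanish.\<close>
  define \<eta> where "\<eta> = \<xi> / (\<bar>a\<bar> + \<bar>b\<bar> + 1)"
  have \<eta>: "\<eta> > 0" "(\<bar>a\<bar> + \<bar>b\<bar>) * \<eta> \<le> \<xi>"
    using \<open>\<xi> > 0\<close> by (auto simp: \<eta>_def field_simps)
  obtain h where h: "continuous_on UNIV h"
    "\<forall>\<^sub>F n in sequentially. \<forall>x. \<bar>f n x - birkhoff_sum T n h x\<bar> \<le> \<eta> * real n"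
    using f \<eta>(1) unfolding AAP_iff[OF cpt T] by blast
  obtain k where k: "continuous_on UNIV k"
    "\<forall>\<^sub>F n in sequentially. \<forall>x. \<bar>g n x - birkhoff_sum T n k x\<bar> \<le> \<eta> * real n"
    using g \<eta>(1) unfolding AAP_iff[OF cpt T] by blast
  have "\<forall>\<^sub>F n in sequentially. \<forall>x. \<bar>a * f n x + b * g n x - birkhoff_sum T n (\<lambda>x. a * h x + b * k x) x\<bar> \<le> \<xi> * real n"
    using h(2) k(2)
  proof eventually_elim
    case (elim n)
    show ?case
    proof
      fix x
      have "\<bar>a * f n x + b * g n x - birkhoff_sum T n (\<lambda>x. a * h x + b * k x) x\<bar>
          = \<bar>a * (f n x - birkhoff_sum T n h x) + b * (g n x - birkhoff_sum T n k x)\<bar>"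
        by (simp add: birkhoff_sum_linear algebra_simps)
      also have "\<dots> \<le> \<bar>a\<bar> * \<bar>f n x - birkhoff_sum T n h x\<bar> + \<bar>b\<bar> * \<bar>g n x - birkhoff_sum T n k x\<bar>"
        using abs_triangle_ineq by (simp only: abs_mult[symmetric])
      also have "\<dots> \<le> \<bar>a\<bar> * (\<eta> * real n) + \<bar>b\<bar> * (\<eta> * real n)"
        using elim by (intro add_mono mult_left_mono) auto
      also have "\<dots> = (\<bar>a\<bar> + \<bar>b\<bar>) * \<eta> * real n"
        by (simp add: algebra_simps)
      also have "\<dots> \<le> \<xi> * real n"
        using \<eta>(2) by (intro mult_right_mono) auto
      finally show "\<bar>a * f n x + b * g n x - birkhoff_sum T n (\<lambda>x. a * h x + b * k x) x\<bar> \<le> \<xi> * real n" .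
    qed
  qed
  moreover have "continuous_on UNIV (\<lambda>x. a * h x + b * k x)"
    using h(1) k(1) by (intro continuous_intros)
  ultimately show "\<exists>h. continuous_on UNIV h \<and>
      (\<forall>\<^sub>F n in sequentially. \<forall>x. \<bar>a * f n x + b * g n x - birkhoff_sum T n h x\<bar> \<le> \<xi> * real n)"
    by blast
qed

lemma AAP_bounded:
  fixes T :: "'a::metric_space \<Rightarrow> 'a"
  assumes cpt: "compact (UNIV :: 'a set)" and T: "continuous_on UNIV T" and f: "AAP T f"
  obtains B where "B > 0" "\<forall>\<^sub>F n in sequentially. \<forall>x. \<bar>f n x\<bar> \<le> B * real n"
proof -
  obtain h where h: "continuous_on UNIV h"
    "\<forall>\<^sub>F n in sequentially. \<forall>x. \<bar>f n x - birkhoff_sum T n h x\<bar> \<le> 1 * real n"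
    using f zero_less_one unfolding AAP_iff[OF cpt T] by blast
  obtain C where C: "C > 0" "\<And>x. \<bar>h x\<bar> \<le> C"
    using compact_continuous_bounded[OF cpt h(1)] by metis
  have "\<forall>\<^sub>F n in sequentially. \<forall>x. \<bar>f n x\<bar> \<le> (C + 1) * real n"
    using h(2)
  proof eventually_elim
    case (elim n)
    show ?case
    proof
      fix x
      show "\<bar>f n x\<bar> \<le> (C + 1) * real n"
        using spec[OF elim, of x] birkhoff_sum_bound[of h C T n x, OF C(2)] by (simp add: algebra_simps)
    qed
  qed
  then show thesis
    using that[of "C + 1"] C(1) by simp
qed

section \<open>Means of potentials under invariant measures\<close>

lemma AAP_integral_close:
  fixes T :: "'a::metric_space \<Rightarrow> 'a"
  assumes cpt: "compact (UNIV :: 'a set)" and T: "continuous_on UNIV T" and f: "AAP T f"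
    and \<mu>: "\<mu> \<in> invariant_measures T" and h: "continuous_on UNIV h"
    and ev: "\<forall>\<^sub>F n in sequentially. \<forall>x. \<bar>f n x - birkhoff_sum T n h x\<bar> \<le> \<xi> * real n"
  shows "\<forall>\<^sub>F n in sequentially. \<bar>(\<integral>x. f n x \<partial>\<mu>) / real n - (\<integral>x. h x \<partial>\<mu>)\<bar> \<le> \<xi>"
  using ev eventually_ge_at_top[of 1]
proof eventually_elim
  case (elim n)
  note \<mu>' = invariant_measuresD[OF \<mu>]
  interpret prob_space \<mu> by (rule \<mu>')
  have int: "integrable \<mu> k" if "continuous_on UNIV k" for k :: "'a \<Rightarrow> real"
    using \<mu>'(2) by (intro continuous_integrable[OF cpt that]) unfold_locales
  have int': "integrable \<mu> (f n)" "integrable \<mu> (birkhoff_sum T n h)"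
    using int[OF AAP_continuous[OF f]] int[OF continuous_on_birkhoff_sum[OF T h]] elim by auto
  have "\<bar>(\<integral>x. f n x \<partial>\<mu>) - (\<integral>x. birkhoff_sum T n h x \<partial>\<mu>)\<bar> = \<bar>\<integral>x. f n x - birkhoff_sum T n h x \<partial>\<mu>\<bar>"
    using int' by simp
  also have "\<dots> \<le> (\<integral>x. \<bar>f n x - birkhoff_sum T n h x\<bar> \<partial>\<mu>)"
    by (rule integral_abs_bound)
  also have "\<dots> \<le> \<xi> * real n"
    using int' elim by (intro integral_le_const) auto
  finally show ?case
    using elim(2) unfolding invariant_integral_birkhoff_sum[OF cpt T \<mu> h] by (simp add: field_simps abs_le_iff)
qed

text \<open>\<open>pot_star\<close> is written with \<open>lim\<close>, which says nothing until
  convergence is known. The averages eventually stay within \<epsilon>/3 of the integral of one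
  continuous function, so they form a Cauchy sequence.\<close>

lemma pot_star_LIMSEQ:
  fixes T :: "'a::metric_space \<Rightarrow> 'a"
  assumes cpt: "compact (UNIV :: 'a set)" and T: "continuous_on UNIV T" and f: "AAP T f"
    and \<mu>: "\<mu> \<in> invariant_measures T"
  shows "(\<lambda>n. (\<integral>x. f n x \<partial>\<mu>) / real n) \<longlonglongrightarrow> pot_star f \<mu>"
proof -
  have "Cauchy (\<lambda>n. (\<integral>x. f n x \<partial>\<mu>) / real n)"
  proof (rule metric_CauchyI)
    fix \<epsilon> :: real assume "\<epsilon> > 0"
    then obtain h where h: "continuous_on UNIV h"
      "\<forall>\<^sub>F n in sequentially. \<forall>x. \<bar>f n x - birkhoff_sum T n h x\<bar> \<le> \<epsilon> / 3 * real n"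
      using f unfolding AAP_iff[OF cpt T] by (meson divide_pos_pos zero_less_numeral)
    then obtain N where N: "\<And>n. n \<ge> N \<Longrightarrow> \<bar>(\<integral>x. f n x \<partial>\<mu>) / real n - (\<integral>x. h x \<partial>\<mu>)\<bar> \<le> \<epsilon> / 3"
      using AAP_integral_close[OF cpt T f \<mu> h] unfolding eventually_sequentially by blast
    have "dist ((\<integral>x. f m x \<partial>\<mu>) / real m) ((\<integral>x. f n x \<partial>\<mu>) / real n) < \<epsilon>" if "m \<ge> N" "n \<ge> N" for m n
      using N[OF that(1)] N[OF that(2)] \<open>\<epsilon> > 0\<close> unfolding dist_real_def by linarith
    then show "\<exists>M. \<forall>m\<ge>M. \<forall>n\<ge>M. dist ((\<integral>x. f m x \<partial>\<mu>) / real m) ((\<integral>x. f n x \<partial>\<mu>) / real n) < \<epsilon>"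
      by blast
  qed
  then show ?thesis
    unfolding pot_star_def by (simp add: Cauchy_convergent_iff convergent_LIMSEQ_iff)
qed

lemma pot_star_close:
  fixes T :: "'a::metric_space \<Rightarrow> 'a"
  assumes "compact (UNIV :: 'a set)" "continuous_on UNIV T" "AAP T f"
    and "\<mu> \<in> invariant_measures T" "continuous_on UNIV h"
    and "\<forall>\<^sub>F n in sequentially. \<forall>x. \<bar>f n x - birkhoff_sum T n h x\<bar> \<le> \<xi> * real n"
  shows "\<bar>pot_star f \<mu> - (\<integral>x. h x \<partial>\<mu>)\<bar> \<le> \<xi>"
proof (rule tendsto_upperbound)
  show "(\<lambda>n. \<bar>(\<integral>x. f n x \<partial>\<mu>) / real n - (\<integral>x. h x \<partial>\<mu>)\<bar>) \<longlonglongrightarrow> \<bar>pot_star f \<mu> - (\<integral>x. h x \<partial>\<mu>)\<bar>"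
    using pot_star_LIMSEQ[OF assms(1-4)] by (intro tendsto_intros)
qed (use AAP_integral_close[OF assms] in auto)

lemma pot_star_linear:
  fixes T :: "'a::metric_space \<Rightarrow> 'a"
  assumes cpt: "compact (UNIV :: 'a set)" and T: "continuous_on UNIV T" and f: "AAP T f" and g: "AAP T g"
    and \<mu>: "\<mu> \<in> invariant_measures T"
  shows "pot_star (\<lambda>n x. a * f n x + b * g n x) \<mu> = a * pot_star f \<mu> + b * pot_star g \<mu>"
proof -
  note \<mu>' = invariant_measuresD[OF \<mu>]
  interpret prob_space \<mu> by (rule \<mu>')
  have int: "integrable \<mu> k" if "continuous_on UNIV k" for k :: "'a \<Rightarrow> real"
    using \<mu>'(2) by (intro continuous_integrable[OF cpt that]) unfold_locales
  have ev: "\<forall>\<^sub>F n in sequentially. a * ((\<integral>x. f n x \<partial>\<mu>) / real n) + b * ((\<integral>x. g n x \<partial>\<mu>) / real n)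
      = (\<integral>x. a * f n x + b * g n x \<partial>\<mu>) / real n"
    using eventually_ge_at_top[of 1]
  proof eventually_elim
    case (elim n)
    then show ?case
      using int[OF AAP_continuous[OF f elim]] int[OF AAP_continuous[OF g elim]] by (simp add: add_divide_distrib)
  qed
  have lim: "(\<lambda>n. a * ((\<integral>x. f n x \<partial>\<mu>) / real n) + b * ((\<integral>x. g n x \<partial>\<mu>) / real n))
      \<longlonglongrightarrow> a * pot_star f \<mu> + b * pot_star g \<mu>"
    using pot_star_LIMSEQ[OF cpt T f \<mu>] pot_star_LIMSEQ[OF cpt T g \<mu>] by (intro tendsto_intros)
  have "(\<lambda>n. (\<integral>x. a * f n x + b * g n x \<partial>\<mu>) / real n) \<longlonglongrightarrow> a * pot_star f \<mu> + b * pot_star g \<mu>"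
    by (rule Lim_transform_eventually[OF lim ev])
  then show ?thesis
    using pot_star_LIMSEQ[OF cpt T AAP_linear[OF cpt T f g] \<mu>] LIMSEQ_unique by blast
qed

lemma pot_star_ge:
  fixes T :: "'a::metric_space \<Rightarrow> 'a"
  assumes cpt: "compact (UNIV :: 'a set)" and T: "continuous_on UNIV T" and g: "AAP T g"
    and \<mu>: "\<mu> \<in> invariant_measures T" and \<sigma>: "\<And>n x. n \<ge> 1 \<Longrightarrow> g n x / real n \<ge> \<sigma>"
  shows "pot_star g \<mu> \<ge> \<sigma>"
proof (rule tendsto_lowerbound[OF pot_star_LIMSEQ[OF cpt T g \<mu>]])
  note \<mu>' = invariant_measuresD[OF \<mu>]
  interpret prob_space \<mu> by (rule \<mu>')
  show "\<forall>\<^sub>F n in sequentially. \<sigma> \<le> (\<integral>x. g n x \<partial>\<mu>) / real n"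
    using eventually_ge_at_top[of 1]
  proof eventually_elim
    case (elim n)
    have "integrable \<mu> (g n)"
      using \<mu>'(2) by (intro continuous_integrable[OF cpt AAP_continuous[OF g elim]]) unfold_locales
    then have "\<sigma> \<le> (\<integral>x. g n x / real n \<partial>\<mu>)"
      using \<sigma>[OF elim] by (intro integral_ge_const) auto
    then show ?case
      by simp
  qed
qed simp

text \<open>A Fatou argument by contradiction: if the averages were eventually below
  \<open>a\<close> at every point, the positive parts of \<open>f n / n - a\<close> would tend to 0
  boundedly, and so would their integrals, which dominate a sequence with limit
  \<open>pot_star f \<mu> - a > 0\<close>. The point obtained need not be generic for
  \<open>\<mu>\<close>.\<close>

lemma AAP_frequently_large:
  fixes T :: "'a::metric_space \<Rightarrow> 'a"
  assumes cpt: "compact (UNIV :: 'a set)" and T: "continuous_on UNIV T" and f: "AAP T f"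
    and \<mu>: "\<mu> \<in> invariant_measures T" and a: "a < pot_star f \<mu>"
  obtains y where "\<exists>\<^sub>F n in sequentially. f n y / real n \<ge> a"
proof (rule ccontr)
  note \<mu>' = invariant_measuresD[OF \<mu>]
  interpret prob_space \<mu> by (rule \<mu>')
  assume "\<not> thesis"
  then have small: "\<forall>\<^sub>F n in sequentially. f n y / real n < a" for y
    using that[of y] by (simp add: frequently_def not_le) blast
  obtain B where B: "B > 0" "\<forall>\<^sub>F n in sequentially. \<forall>x. \<bar>f n x\<bar> \<le> B * real n"
    using AAP_bounded[OF cpt T f] by metis
  then obtain N where N: "N \<ge> 1" "\<And>n x. n \<ge> N \<Longrightarrow> \<bar>f n x\<bar> \<le> B * real n"
    using eventually_conj[OF B(2) eventually_ge_at_top[of 1]] unfolding eventually_sequentially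
    by (metis le_trans nat_le_linear)
  \<comment> \<open>After the shift by \<open>N\<close> the bound by \<open>B\<close> holds for
    every index, so a constant dominates the whole sequence.\<close>
  define k where "k n x = max (f (n + N) x / real (n + N) - a) 0" for n x
  have f_cont: "continuous_on UNIV (f (n + N))" for n
    using N(1) by (intro AAP_continuous[OF f]) auto
  have int_f: "integrable \<mu> (f (n + N))" for n
    using \<mu>'(2) by (intro continuous_integrable[OF cpt f_cont]) unfold_locales
  have "continuous_on UNIV (k n)" for n
    unfolding k_def[abs_def] using f_cont N(1) by (intro continuous_intros) auto
  then have k_int: "integrable \<mu> (k n)" for n
    using \<mu>'(2) finite_measure_axioms by (intro continuous_integrable[OF cpt])
  have k_meas: "k n \<in> borel_measurable \<mu>" for n
    by (rule borel_measurable_integrable[OF k_int])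
  have k_lim: "(\<lambda>n. \<integral>x. k n x \<partial>\<mu>) \<longlonglongrightarrow> (\<integral>x. 0 \<partial>\<mu>)"
  proof (rule integral_dominated_convergence[where w = "\<lambda>_. B + \<bar>a\<bar>"])
    show "AE x in \<mu>. (\<lambda>n. k n x) \<longlonglongrightarrow> 0"
    proof (rule AE_I2)
      fix x
      have "\<forall>\<^sub>F n in sequentially. f (n + N) x / real (n + N) < a"
        using small[of x] by (rule eventually_all_ge_at_top[THEN eventually_mono, THEN sequentially_offset]) auto
      then have "\<forall>\<^sub>F n in sequentially. k n x = 0"
        by eventually_elim (simp add: k_def)
      then show "(\<lambda>n. k n x) \<longlonglongrightarrow> 0"
        by (rule tendsto_eventually)
    qed
    show "AE x in \<mu>. norm (k n x) \<le> B + \<bar>a\<bar>" for n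
    proof (rule AE_I2)
      fix x
      have "\<bar>f (n + N) x / real (n + N)\<bar> \<le> B"
        using N(2)[of "n + N" x] N(1) by (simp add: field_simps)
      then show "norm (k n x) \<le> B + \<bar>a\<bar>"
        using B(1) unfolding k_def real_norm_def by linarith
    qed
  qed (use k_meas in auto)
  have f_lim: "(\<lambda>n. (\<integral>x. f (n + N) x \<partial>\<mu>) / real (n + N) - a) \<longlonglongrightarrow> pot_star f \<mu> - a"
    using LIMSEQ_ignore_initial_segment[OF pot_star_LIMSEQ[OF cpt T f \<mu>]] by (intro tendsto_intros)
  have "(\<integral>x. f (n + N) x \<partial>\<mu>) / real (n + N) - a \<le> (\<integral>x. k n x \<partial>\<mu>)" for n
  proof -
    have "(\<integral>x. f (n + N) x \<partial>\<mu>) / real (n + N) - a = (\<integral>x. f (n + N) x / real (n + N) - a \<partial>\<mu>)"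
      using int_f prob_space by simp
    also have "\<dots> \<le> (\<integral>x. k n x \<partial>\<mu>)"
      using int_f k_int by (intro integral_mono) (auto simp: k_def)
    finally show ?thesis .
  qed
  then have "pot_star f \<mu> - a \<le> (\<integral>x. 0 \<partial>\<mu>)"
    by (intro LIMSEQ_le[OF f_lim k_lim]) auto
  then show False
    using a by simp
qed

section \<open>Empirical measures along an orbit\<close>

lemma empirical_limits_subset_invariant:
  fixes T :: "'a::metric_space \<Rightarrow> 'a"
  assumes cpt: "compact (UNIV :: 'a set)" and T: "continuous_on UNIV T"
  shows "empirical_limits T x \<subseteq> invariant_measures T"
proof
  fix \<mu> assume "\<mu> \<in> empirical_limits T x"
  then obtain r where \<mu>: "prob_space \<mu>" "sets \<mu> = sets borel" and r: "strict_mono r"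
    and lim: "\<And>h :: 'a \<Rightarrow> real. continuous_on UNIV h \<Longrightarrow>
      (\<lambda>k. birkhoff_sum T (r k) h x / real (r k)) \<longlonglongrightarrow> (\<integral>y. h y \<partial>\<mu>)"
    unfolding empirical_limits_def by blast
  show "\<mu> \<in> invariant_measures T"
  proof (rule invariant_measuresI[OF cpt T \<mu>])
    fix h :: "'a \<Rightarrow> real" assume h: "continuous_on UNIV h"
    have hT: "continuous_on UNIV (\<lambda>x. h (T x))"
      by (rule continuous_on_compose2[OF h T]) simp
    obtain C where C: "\<And>x. \<bar>h x\<bar> \<le> C"
      using compact_continuous_bounded[OF cpt h] by metis
    \<comment> \<open>The Krylov-Bogolyubov argument: composing with \<open>T\<close> shifts the sum
      by one place, and the two boundary terms disappear after division by \<open>n\<close>.\<close>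
    have tele: "birkhoff_sum T n (\<lambda>x. h (T x)) x - birkhoff_sum T n h x = h ((T ^^ n) x) - h x" for n
      unfolding birkhoff_sum_def using sum_lessThan_telescope[of "\<lambda>i. h ((T ^^ i) x)" n]
      by (simp add: sum_subtractf)
    have "(\<lambda>n. (h ((T ^^ n) x) - h x) / real n) \<longlonglongrightarrow> 0"
    proof (rule Lim_null_comparison)
      show "\<forall>\<^sub>F n in sequentially. norm ((h ((T ^^ n) x) - h x) / real n) \<le> 2 * C / real n"
      proof (intro always_eventually allI)
        fix n
        have "\<bar>h ((T ^^ n) x) - h x\<bar> \<le> 2 * C"
          using C[of x] C[of "(T ^^ n) x"] by linarith
        then show "norm ((h ((T ^^ n) x) - h x) / real n) \<le> 2 * C / real n"
          by (simp add: divide_right_mono)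
      qed
      show "(\<lambda>n. 2 * C / real n) \<longlonglongrightarrow> 0"
        by (rule lim_const_over_n)
    qed
    then have "(\<lambda>k. (h ((T ^^ r k) x) - h x) / real (r k)) \<longlonglongrightarrow> 0"
      using LIMSEQ_subseq_LIMSEQ[OF _ r] by (fastforce simp: o_def)
    moreover have "(\<lambda>k. (h ((T ^^ r k) x) - h x) / real (r k)) \<longlonglongrightarrow> (\<integral>x. h (T x) \<partial>\<mu>) - (\<integral>x. h x \<partial>\<mu>)"
      using tendsto_diff[OF lim[OF hT] lim[OF h]] by (simp add: tele diff_divide_distrib[symmetric])
    ultimately show "(\<integral>x. h (T x) \<partial>\<mu>) = (\<integral>x. h x \<partial>\<mu>)"
      using LIMSEQ_unique by fastforce
  qed
qed

text \<open>Weak convergence concerns a fixed function, whereas \<open>f\<close> changes with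
  \<open>n\<close>. The passage goes through one \<open>h\<close> whose Birkhoff sums approximate
  \<open>f\<close> uniformly; three errors of \<epsilon>/4 stay strictly below \<epsilon>.\<close>

lemma AAP_empirical_LIMSEQ:
  fixes T :: "'a::metric_space \<Rightarrow> 'a"
  assumes cpt: "compact (UNIV :: 'a set)" and T: "continuous_on UNIV T" and f: "AAP T f"
    and \<mu>: "\<mu> \<in> invariant_measures T" and r: "strict_mono r"
    and lim: "\<And>h :: 'a \<Rightarrow> real. continuous_on UNIV h \<Longrightarrow>
      (\<lambda>k. birkhoff_sum T (r k) h x / real (r k)) \<longlonglongrightarrow> (\<integral>y. h y \<partial>\<mu>)"
  shows "(\<lambda>k. f (r k) x / real (r k)) \<longlonglongrightarrow> pot_star f \<mu>"
proof (rule LIMSEQ_I)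
  fix \<epsilon> :: real assume "\<epsilon> > 0"
  then obtain h where h: "continuous_on UNIV h"
    "\<forall>\<^sub>F n in sequentially. \<forall>x. \<bar>f n x - birkhoff_sum T n h x\<bar> \<le> \<epsilon> / 4 * real n"
    using f unfolding AAP_iff[OF cpt T] by (meson divide_pos_pos zero_less_numeral)
  have "\<forall>\<^sub>F k in sequentially. \<forall>x. \<bar>f (r k) x - birkhoff_sum T (r k) h x\<bar> \<le> \<epsilon> / 4 * real (r k)"
    by (rule eventually_subseq[OF r h(2)])
  moreover have "\<forall>\<^sub>F k in sequentially. dist (birkhoff_sum T (r k) h x / real (r k)) (\<integral>y. h y \<partial>\<mu>) < \<epsilon> / 4"
    using \<open>\<epsilon> > 0\<close> by (intro tendstoD[OF lim[OF h(1)]]) simp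
  moreover have "\<forall>\<^sub>F k in sequentially. 1 \<le> r k"
    by (rule eventually_subseq[OF r eventually_ge_at_top])
  ultimately have "\<forall>\<^sub>F k in sequentially. norm (f (r k) x / real (r k) - pot_star f \<mu>) < \<epsilon>"
  proof eventually_elim
    case (elim k)
    have "\<bar>f (r k) x / real (r k) - birkhoff_sum T (r k) h x / real (r k)\<bar>
        = \<bar>f (r k) x - birkhoff_sum T (r k) h x\<bar> / real (r k)"
      by (simp add: diff_divide_distrib[symmetric])
    also have "\<dots> \<le> \<epsilon> / 4"
      using elim(1,3) by (simp add: divide_le_eq)
    finally show ?case
      using elim(2) pot_star_close[OF cpt T f \<mu> h] \<open>\<epsilon> > 0\<close> unfolding dist_real_def real_norm_def by linarith
  qed
  then show "\<exists>N. \<forall>k\<ge>N. norm (f (r k) x / real (r k) - pot_star f \<mu>) < \<epsilon>"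
    by (simp add: eventually_sequentially)
qed

lemma empirical_limit_exists:
  fixes T :: "'a::metric_space \<Rightarrow> 'a" and r :: "nat \<Rightarrow> nat"
  assumes cpt: "compact (UNIV :: 'a set)" and T: "continuous_on UNIV T" and r: "strict_mono r"
  obtains s \<nu> where "strict_mono s" "prob_space \<nu>" "sets \<nu> = sets borel"
    "\<And>h :: 'a \<Rightarrow> real. continuous_on UNIV h \<Longrightarrow>
      (\<lambda>k. birkhoff_sum T (r (s k)) h x / real (r (s k))) \<longlonglongrightarrow> (\<integral>y. h y \<partial>\<nu>)"
proof -
  \<comment> \<open>The empirical measure, as the image of the uniform distribution on the times
    below \<open>n\<close>. For \<open>n = 0\<close> the distribution is unspecified but still a
    probability measure, so compactness applies to the whole sequence.\<close>
  define \<mu> where "\<mu> n = distr (measure_pmf (pmf_of_set {..<n})) borel (\<lambda>i. (T ^^ i) x)" for n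
  have \<mu>: "prob_space (\<mu> n)" "sets (\<mu> n) = sets borel" for n
    unfolding \<mu>_def by (auto intro!: prob_space.prob_space_distr measure_pmf.prob_space_axioms)
  have int: "(\<integral>y. h y \<partial>\<mu> n) = birkhoff_sum T n h x / real n" if "continuous_on UNIV h" "n \<ge> 1"
    for h :: "'a \<Rightarrow> real" and n
    unfolding \<mu>_def birkhoff_sum_def using that borel_measurable_continuous_onI[OF that(1)]
    by (subst integral_distr) (auto simp: integral_pmf_of_set lessThan_empty_iff)
  obtain s \<nu> where s: "strict_mono s" and \<nu>: "prob_space \<nu>" "sets \<nu> = sets borel"
    and lim: "\<And>h :: 'a \<Rightarrow> real. continuous_on UNIV h \<Longrightarrow> (\<lambda>k. \<integral>y. h y \<partial>\<mu> (r (s k))) \<longlonglongrightarrow> (\<integral>y. h y \<partial>\<nu>)"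
    using prob_measures_weak_seq_compact[of "\<lambda>k. \<mu> (r k)", OF cpt \<mu>] by blast
  have "(\<lambda>k. birkhoff_sum T (r (s k)) h x / real (r (s k))) \<longlonglongrightarrow> (\<integral>y. h y \<partial>\<nu>)"
    if h: "continuous_on UNIV h" for h :: "'a \<Rightarrow> real"
  proof (rule Lim_transform_eventually[OF lim[OF h]])
    have "strict_mono (\<lambda>k. r (s k))"
      using strict_mono_o[OF r s] by (simp add: o_def)
    then have "\<forall>\<^sub>F k in sequentially. 1 \<le> r (s k)"
      by (rule eventually_subseq[OF _ eventually_ge_at_top])
    then show "\<forall>\<^sub>F k in sequentially. (\<integral>y. h y \<partial>\<mu> (r (s k))) = birkhoff_sum T (r (s k)) h x / real (r (s k))"
      by eventually_elim (rule int[OF h])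
  qed
  with s \<nu> show thesis
    by (rule that)
qed

lemma limsup_ratio_eq_SUP_empirical_limits:
  fixes T :: "'a::metric_space \<Rightarrow> 'a"
  assumes cpt: "compact (UNIV :: 'a set)" and T: "continuous_on UNIV T" and f: "AAP T f" and g: "AAP T g"
    and \<sigma>: "\<sigma> > 0" "\<And>n x. n \<ge> 1 \<Longrightarrow> g n x / real n \<ge> \<sigma>"
  shows "limsup (\<lambda>n. ereal (f n x / g n x)) = (SUP \<mu>\<in>empirical_limits T x. ereal (pot_star f \<mu> / pot_star g \<mu>))"
proof (rule antisym)
  have lim: "(\<lambda>k. ereal (f (r k) x / g (r k) x)) \<longlonglongrightarrow> ereal (pot_star f \<mu> / pot_star g \<mu>)"
    if \<mu>: "\<mu> \<in> invariant_measures T" and r: "strict_mono r"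
      and conv: "\<And>h :: 'a \<Rightarrow> real. continuous_on UNIV h \<Longrightarrow>
        (\<lambda>k. birkhoff_sum T (r k) h x / real (r k)) \<longlonglongrightarrow> (\<integral>y. h y \<partial>\<mu>)" for r \<mu>
  proof -
    have "pot_star g \<mu> \<noteq> 0"
      using pot_star_ge[OF cpt T g \<mu> \<sigma>(2)] \<sigma>(1) by simp
    then have "(\<lambda>k. (f (r k) x / real (r k)) / (g (r k) x / real (r k))) \<longlonglongrightarrow> pot_star f \<mu> / pot_star g \<mu>"
      using AAP_empirical_LIMSEQ[OF cpt T f \<mu> r conv] AAP_empirical_LIMSEQ[OF cpt T g \<mu> r conv]
      by (intro tendsto_divide)
    moreover have "\<forall>\<^sub>F k in sequentially. (f (r k) x / real (r k)) / (g (r k) x / real (r k)) = f (r k) x / g (r k) x"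
      using eventually_subseq[OF r eventually_ge_at_top[of 1]] by eventually_elim simp
    ultimately show ?thesis
      by (auto intro: Lim_transform_eventually)
  qed
  show "(SUP \<mu>\<in>empirical_limits T x. ereal (pot_star f \<mu> / pot_star g \<mu>)) \<le> limsup (\<lambda>n. ereal (f n x / g n x))"
  proof (rule SUP_least)
    fix \<mu> assume \<mu>: "\<mu> \<in> empirical_limits T x"
    then obtain r where r: "strict_mono r" and conv: "\<And>h :: 'a \<Rightarrow> real. continuous_on UNIV h \<Longrightarrow>
        (\<lambda>k. birkhoff_sum T (r k) h x / real (r k)) \<longlonglongrightarrow> (\<integral>y. h y \<partial>\<mu>)"
      unfolding empirical_limits_def by blast
    have "\<mu> \<in> invariant_measures T"
      using \<mu> empirical_limits_subset_invariant[OF cpt T] by blast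
    from lim_imp_Limsup[OF _ lim[OF this r conv]]
    have "ereal (pot_star f \<mu> / pot_star g \<mu>) = limsup ((\<lambda>n. ereal (f n x / g n x)) \<circ> r)"
      by (simp add: o_def)
    then show "ereal (pot_star f \<mu> / pot_star g \<mu>) \<le> limsup (\<lambda>n. ereal (f n x / g n x))"
      using limsup_subseq_mono[OF r] by simp
  qed
  \<comment> \<open>A subsequence realising the limsup is thinned out until its empirical measures
    converge; the limit measure then attains the supremum.\<close>
  obtain r where r: "strict_mono r"
    and r_lim: "((\<lambda>n. ereal (f n x / g n x)) \<circ> r) \<longlonglongrightarrow> limsup (\<lambda>n. ereal (f n x / g n x))"
    using limsup_subseq_lim by blast
  obtain s \<nu> where s: "strict_mono s" and \<nu>: "prob_space \<nu>" "sets \<nu> = sets borel"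
    and conv: "\<And>h :: 'a \<Rightarrow> real. continuous_on UNIV h \<Longrightarrow>
      (\<lambda>k. birkhoff_sum T (r (s k)) h x / real (r (s k))) \<longlonglongrightarrow> (\<integral>y. h y \<partial>\<nu>)"
    using empirical_limit_exists[OF cpt T r, of x] by blast
  have rs: "strict_mono (\<lambda>k. r (s k))"
    using strict_mono_o[OF r s] by (simp add: o_def)
  have \<nu>_emp: "\<nu> \<in> empirical_limits T x"
    unfolding empirical_limits_def using \<nu> rs conv by blast
  then have \<nu>_inv: "\<nu> \<in> invariant_measures T"
    using empirical_limits_subset_invariant[OF cpt T] by blast
  have "limsup (\<lambda>n. ereal (f n x / g n x)) = ereal (pot_star f \<nu> / pot_star g \<nu>)"
    using LIMSEQ_unique[OF LIMSEQ_subseq_LIMSEQ[OF r_lim s, unfolded o_def] lim[OF \<nu>_inv rs conv]] .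
  then show "limsup (\<lambda>n. ereal (f n x / g n x)) \<le> (SUP \<mu>\<in>empirical_limits T x. ereal (pot_star f \<mu> / pot_star g \<mu>))"
    using SUP_upper[OF \<nu>_emp] by simp
qed

section \<open>Specification\<close>

text \<open>Points shadowing the first \<open>k\<close> segments accumulate somewhere, and by
  continuity of every iterate the limit shadows all segments, with strict inequality weakened. The
  gap \<open>m\<close> depends on \<epsilon> alone, so segments may be as long as desired.\<close>

lemma specification_infinite:
  fixes T :: "'a::metric_space \<Rightarrow> 'a"
  assumes cpt: "compact (UNIV :: 'a set)" and T: "continuous_on UNIV T"
    and spec: "specification_property T" and "\<epsilon> > 0"
  obtains m where "\<And>a b xs. \<lbrakk>\<And>j. a j \<le> b j; \<And>j. b j + m \<le> a (Suc j)\<rbrakk> \<Longrightarrow>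
    \<exists>x. \<forall>j. \<forall>p\<le>b j - a j. dist ((T ^^ (p + a j)) x) ((T ^^ p) (xs j)) \<le> \<epsilon>"
proof -
  from spec[unfolded specification_property_def, THEN HOL.spec, THEN mp, OF \<open>\<epsilon> > 0\<close>]
  obtain m where m: "\<forall>k a b xs. (\<forall>j<k. a j \<le> b j) \<and> (\<forall>j. Suc j < k \<longrightarrow> b j + m \<le> a (Suc j)) \<longrightarrow>
    (\<exists>x. \<forall>j<k. \<forall>p\<le>b j - a j. dist ((T ^^ (p + a j)) x) ((T ^^ p) (xs j)) < \<epsilon>)"
    by (rule exE)
  show thesis
  proof (rule that)
    fix a b :: "nat \<Rightarrow> nat" and xs :: "nat \<Rightarrow> 'a"
    assume ab: "\<And>j. a j \<le> b j" "\<And>j. b j + m \<le> a (Suc j)"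
    have "\<forall>k. \<exists>x. \<forall>j<k. \<forall>p\<le>b j - a j. dist ((T ^^ (p + a j)) x) ((T ^^ p) (xs j)) < \<epsilon>"
      using m ab by simp
    from choice[OF this] obtain X where
      X: "\<And>k j p. \<lbrakk>j < k; p \<le> b j - a j\<rbrakk> \<Longrightarrow> dist ((T ^^ (p + a j)) (X k)) ((T ^^ p) (xs j)) < \<epsilon>"
      by blast
    obtain x r where r: "strict_mono r" "(X \<circ> r) \<longlonglongrightarrow> x"
      using seq_compactE[OF cpt[unfolded compact_eq_seq_compact_metric], of X] by blast
    have "dist ((T ^^ (p + a j)) x) ((T ^^ p) (xs j)) \<le> \<epsilon>" if p: "p \<le> b j - a j" for j p
    proof (rule tendsto_upperbound)
      have "isCont (T ^^ (p + a j)) x"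
        using continuous_on_funpow[OF T] continuous_on_eq_continuous_at[OF open_UNIV] by blast
      then have "(\<lambda>k. (T ^^ (p + a j)) ((X \<circ> r) k)) \<longlonglongrightarrow> (T ^^ (p + a j)) x"
        using r(2) by (rule isCont_tendsto_compose)
      then show "(\<lambda>k. dist ((T ^^ (p + a j)) ((X \<circ> r) k)) ((T ^^ p) (xs j))) \<longlonglongrightarrow> dist ((T ^^ (p + a j)) x) ((T ^^ p) (xs j))"
        by (intro tendsto_intros)
      show "\<forall>\<^sub>F k in sequentially. dist ((T ^^ (p + a j)) ((X \<circ> r) k)) ((T ^^ p) (xs j)) \<le> \<epsilon>"
        using eventually_gt_at_top[of j]
      proof eventually_elim
        case (elim k)
        then have "j < r k"
          using seq_suble[OF r(1), of k] by simp
        then show ?case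
          using X[OF _ p] by (auto intro: less_imp_le)
      qed
    qed simp
    then show "\<exists>x. \<forall>j. \<forall>p\<le>b j - a j. dist ((T ^^ (p + a j)) x) ((T ^^ p) (xs j)) \<le> \<epsilon>"
      by blast
  qed
qed

text \<open>Each orbit segment is chosen so long that everything before it is negligible.\<close>
lemma specification_long_segments:
  fixes T :: "'a::metric_space \<Rightarrow> 'a" and y :: "nat \<Rightarrow> 'a"
  assumes cpt: "compact (UNIV :: 'a set)" and T: "continuous_on UNIV T"
    and spec: "specification_property T" and "\<epsilon> > 0"
    and freq: "\<And>j. \<exists>\<^sub>F n in sequentially. P j n"
  obtains x a n where "\<And>j. P j (n j)" "\<And>j. a j * Suc j \<le> n j" "\<And>j. j < n j"
    "\<And>j p. p < n j \<Longrightarrow> dist ((T ^^ (p + a j)) x) ((T ^^ p) (y j)) \<le> \<epsilon>"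
proof -
  obtain m where m: "\<And>a b xs. \<lbrakk>\<And>j. a j \<le> b j; \<And>j. b j + m \<le> a (Suc j)\<rbrakk> \<Longrightarrow>
    \<exists>x. \<forall>j. \<forall>p\<le>b j - a j. dist ((T ^^ (p + a j)) x) ((T ^^ p) (xs j)) \<le> \<epsilon>"
    using specification_infinite[OF cpt T spec \<open>\<epsilon> > 0\<close>] by blast
  \<comment> \<open>Good lengths exist beyond any bound. The factor \<open>Suc j\<close> makes the
    preceding time \<open>s\<close> at most a fraction \<open>1 / Suc j\<close> of the segment, and
    \<open>j < n\<close> drives the lengths to infinity.\<close>
  have "\<exists>n. P j n \<and> s * Suc j \<le> n \<and> j < n" for j s
    using frequently_eventually_frequently[OF freq[of j] eventually_ge_at_top[of "s * Suc j + Suc j"]]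
    by (auto dest!: frequently_ex)
  then obtain N where N: "\<And>j s. P j (N j s)" "\<And>j s. s * Suc j \<le> N j s" "\<And>j s. j < N j s"
    by metis
  \<comment> \<open>The length of a segment depends on its starting time, so starts and lengths are
    built together: start, segment, gap \<open>m\<close>. The last time of a segment is
    \<open>a j + n j - 1\<close>, one less than its end here.\<close>
  define a where "a = rec_nat 0 (\<lambda>j s. s + N j s + m)"
  define n where "n j = N j (a j)" for j
  have a_Suc: "a (Suc j) = a j + n j + m" for j
    by (simp add: a_def n_def)
  have n_pos: "n j \<ge> 1" for j
    using N(3)[of j "a j"] by (simp add: n_def)
  have "\<exists>x. \<forall>j. \<forall>p\<le>(a j + n j - 1) - a j. dist ((T ^^ (p + a j)) x) ((T ^^ p) (y j)) \<le> \<epsilon>"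
  proof (rule m)
    show "a j \<le> a j + n j - 1" for j
      using n_pos[of j] by linarith
    show "a j + n j - 1 + m \<le> a (Suc j)" for j
      by (simp add: a_Suc)
  qed
  then obtain x where x: "\<And>j p. p \<le> (a j + n j - 1) - a j \<Longrightarrow> dist ((T ^^ (p + a j)) x) ((T ^^ p) (y j)) \<le> \<epsilon>"
    by blast
  show thesis
  proof (rule that)
    show "P j (n j)" "a j * Suc j \<le> n j" "j < n j" for j
      unfolding n_def by (rule N)+
    show "dist ((T ^^ (p + a j)) x) ((T ^^ p) (y j)) \<le> \<epsilon>" if "p < n j" for j p
      using that by (intro x) auto
  qed
qed

text \<open>The last \<open>n\<close> terms are compared one by one. The prefix of length
  \<open>a\<close> contributes at most \<open>C * a / (a + n)\<close>, and replacing the divisor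
  \<open>n\<close> by \<open>a + n\<close> costs the same again, whence the factor 2.\<close>

lemma birkhoff_average_shadowing:
  assumes C: "\<And>x. \<bar>h x\<bar> \<le> C" and n: "n \<ge> 1"
    and sh: "\<And>p. p < n \<Longrightarrow> \<bar>h ((T ^^ (p + a)) x) - h ((T ^^ p) y)\<bar> \<le> \<omega>"
  shows "\<bar>birkhoff_sum T (a + n) h x / real (a + n) - birkhoff_sum T n h y / real n\<bar>
    \<le> \<omega> + 2 * C * real a / real (a + n)"
proof -
  define A where "A = birkhoff_sum T a h x"
  define B where "B = birkhoff_sum T n h y"
  define E where "E = birkhoff_sum T n h ((T ^^ a) x) - B"
  have E: "\<bar>E\<bar> \<le> \<omega> * real n"
  proof -
    have "\<bar>E\<bar> = \<bar>\<Sum>p<n. h ((T ^^ (p + a)) x) - h ((T ^^ p) y)\<bar>"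
      by (simp add: E_def B_def birkhoff_sum_def sum_subtractf funpow_add)
    also have "\<dots> \<le> (\<Sum>p<n. \<bar>h ((T ^^ (p + a)) x) - h ((T ^^ p) y)\<bar>)"
      by (rule sum_abs)
    also have "\<dots> \<le> (\<Sum>p<n. \<omega>)"
      using sh by (intro sum_mono) simp
    finally show ?thesis
      by (simp add: mult.commute)
  qed
  have "\<omega> \<ge> 0"
    using sh[of 0] n by (auto intro: order_trans[OF abs_ge_zero])
  have A: "\<bar>A\<bar> \<le> C * real a" and B: "\<bar>B\<bar> \<le> C * real n"
    unfolding A_def B_def by (rule birkhoff_sum_bound[OF C])+
  have "birkhoff_sum T (a + n) h x / real (a + n) - B / real n
      = A / real (a + n) + E / real (a + n) - (B / real n) * (real a / real (a + n))"
  proof -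
    have "birkhoff_sum T (a + n) h x / real (a + n) = A / real (a + n) + E / real (a + n) + B / real (a + n)"
      by (simp add: birkhoff_sum_add A_def E_def add_divide_distrib[symmetric])
    moreover have "B / real (a + n) = B / real n - (B / real n) * (real a / real (a + n))"
      using n by (simp add: divide_simps) (simp add: algebra_simps)
    ultimately show ?thesis
      by simp
  qed
  also have "\<bar>\<dots>\<bar> \<le> \<bar>A / real (a + n)\<bar> + \<bar>E / real (a + n)\<bar> + \<bar>(B / real n) * (real a / real (a + n))\<bar>"
    by linarith
  also have "\<dots> \<le> C * real a / real (a + n) + \<omega> + C * (real a / real (a + n))"
  proof (intro add_mono)
    show "\<bar>A / real (a + n)\<bar> \<le> C * real a / real (a + n)"
      using A by (simp add: divide_right_mono)
    have "\<omega> * real n \<le> \<omega> * real (a + n)"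
      using \<open>\<omega> \<ge> 0\<close> by (intro mult_left_mono) auto
    with E have "\<bar>E\<bar> \<le> \<omega> * real (a + n)"
      by linarith
    then show "\<bar>E / real (a + n)\<bar> \<le> \<omega>"
      using n by (simp add: divide_le_eq)
    have "\<bar>B / real n\<bar> \<le> C"
      using B n by (simp add: divide_le_eq)
    then show "\<bar>(B / real n) * (real a / real (a + n))\<bar> \<le> C * (real a / real (a + n))"
      unfolding abs_mult using order_trans[OF abs_ge_zero C] by (intro mult_mono) auto
  qed
  finally show ?thesis
    by (simp add: B_def)
qed

text \<open>The radius comes from the uniform continuity of one approximating \<open>h\<close>, so
  it is fixed before the segments are. The error is made of four quarters of \<delta>: two for
  exchanging \<open>f\<close> and \<open>h\<close>, one for the shadowing, one for the
  prefix.\<close>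

lemma AAP_shadowing:
  fixes T :: "'a::metric_space \<Rightarrow> 'a"
  assumes cpt: "compact (UNIV :: 'a set)" and T: "continuous_on UNIV T" and f: "AAP T f" and "\<delta> > 0"
  shows "\<exists>\<epsilon>>0. \<forall>x a n y. (\<forall>j. a j * Suc j \<le> n j) \<longrightarrow> (\<forall>j. j < n j) \<longrightarrow>
    (\<forall>j. \<forall>p<n j. dist ((T ^^ (p + a j)) x) ((T ^^ p) (y j)) \<le> \<epsilon>) \<longrightarrow>
    (\<forall>\<^sub>F j in sequentially. \<bar>f (a j + n j) x / real (a j + n j) - f (n j) (y j) / real (n j)\<bar> \<le> \<delta>)"
proof -
  obtain h where h: "continuous_on UNIV h"
    and close: "\<forall>\<^sub>F n in sequentially. \<forall>x. \<bar>f n x - birkhoff_sum T n h x\<bar> \<le> \<delta> / 4 * real n"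
    using f \<open>\<delta> > 0\<close> unfolding AAP_iff[OF cpt T] by (meson divide_pos_pos zero_less_numeral)
  obtain N where N: "\<And>n x. n \<ge> N \<Longrightarrow> \<bar>f n x - birkhoff_sum T n h x\<bar> \<le> \<delta> / 4 * real n"
    using close unfolding eventually_sequentially by blast
  have N': "\<bar>f n x / real n - birkhoff_sum T n h x / real n\<bar> \<le> \<delta> / 4" if "n \<ge> N" "n \<ge> 1" for n x
    using N[OF that(1), of x] that(2) by (simp add: diff_divide_distrib[symmetric] divide_le_eq)
  obtain C where C: "C > 0" "\<And>x. \<bar>h x\<bar> \<le> C"
    using compact_continuous_bounded[OF cpt h] by metis
  have "uniformly_continuous_on UNIV h"
    using compact_uniformly_continuous[OF h cpt] .
  then obtain \<epsilon> where \<epsilon>: "\<epsilon> > 0" "\<And>x y. dist x y < \<epsilon> \<Longrightarrow> \<bar>h x - h y\<bar> < \<delta> / 4"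
    using \<open>\<delta> > 0\<close> unfolding uniformly_continuous_on_def dist_real_def
    by (metis UNIV_I divide_pos_pos zero_less_numeral)
  show ?thesis
  \<comment> \<open>Shadowing is only known with a weak inequality, uniform continuity asks for a
    strict one; hence the half.\<close>
  proof (intro exI[of _ "\<epsilon> / 2"] conjI allI impI)
    show "\<epsilon> / 2 > 0"
      using \<epsilon> by simp
    fix x and a n :: "nat \<Rightarrow> nat" and y
    assume an: "\<forall>j. a j * Suc j \<le> n j" "\<forall>j. j < n j"
      and sh: "\<forall>j. \<forall>p<n j. dist ((T ^^ (p + a j)) x) ((T ^^ p) (y j)) \<le> \<epsilon> / 2"
    \<comment> \<open>The threshold at which \<open>a j * Suc j \<le> n j\<close> brings the prefix
      term \<open>2 * C * a j / (a j + n j)\<close> down to \<delta>/4.\<close>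
    have "\<forall>\<^sub>F j in sequentially. 8 * C / \<delta> \<le> real j"
      using eventually_ge_at_top[of "nat \<lceil>8 * C / \<delta>\<rceil>"] by eventually_elim (simp add: nat_ceiling_le_eq)
    then show "\<forall>\<^sub>F j in sequentially. \<bar>f (a j + n j) x / real (a j + n j) - f (n j) (y j) / real (n j)\<bar> \<le> \<delta>"
      using eventually_ge_at_top[of N]
    proof eventually_elim
      case (elim j)
      have "j < n j"
        using an(2) by blast
      then have nj: "n j \<ge> N" "n j \<ge> 1" "a j + n j \<ge> N" "a j + n j \<ge> 1"
        using elim(2) by auto
      have "\<bar>birkhoff_sum T (a j + n j) h x / real (a j + n j) - birkhoff_sum T (n j) h (y j) / real (n j)\<bar>
          \<le> \<delta> / 4 + 2 * C * real (a j) / real (a j + n j)"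
      proof (rule birkhoff_average_shadowing[OF C(2) nj(2)])
        fix p assume "p < n j"
        then have "dist ((T ^^ (p + a j)) x) ((T ^^ p) (y j)) \<le> \<epsilon> / 2"
          using sh by blast
        then have "dist ((T ^^ (p + a j)) x) ((T ^^ p) (y j)) < \<epsilon>"
          using \<epsilon>(1) by simp
        then show "\<bar>h ((T ^^ (p + a j)) x) - h ((T ^^ p) (y j))\<bar> \<le> \<delta> / 4"
          using \<epsilon>(2) by (auto intro: less_imp_le)
      qed
      moreover have "2 * C * real (a j) / real (a j + n j) \<le> \<delta> / 4"
      proof -
        have "8 * C * real (a j) \<le> (\<delta> * real j) * real (a j)"
          using elim(1) \<open>\<delta> > 0\<close> by (intro mult_right_mono) (auto simp: divide_le_eq mult.commute)
        also have "\<dots> \<le> \<delta> * real (a j * Suc j)"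
          using \<open>\<delta> > 0\<close> by (simp add: algebra_simps)
        also have "\<dots> \<le> \<delta> * real (a j + n j)"
        proof (rule mult_left_mono)
          show "real (a j * Suc j) \<le> real (a j + n j)"
            using spec[OF an(1), of j] by (simp only: of_nat_le_iff)
        qed (use \<open>\<delta> > 0\<close> in simp)
        finally show ?thesis
          using nj(4) by (simp add: divide_le_eq)
      qed
      ultimately show ?case
        using N'[OF nj(1,2), of "y j"] N'[OF nj(3,4), of x] by linarith
    qed
  qed
qed

text \<open>The orbits of \<open>y 0, \<dots>, y (K - 1)\<close> are visited cyclically.\<close>
lemma specification_common_point:
  fixes T :: "'a::metric_space \<Rightarrow> 'a" and f :: "nat \<Rightarrow> nat \<Rightarrow> 'a \<Rightarrow> real"
  assumes cpt: "compact (UNIV :: 'a set)" and T: "continuous_on UNIV T"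
    and spec: "specification_property T" and f: "\<And>i. i < K \<Longrightarrow> AAP T (f i)" and "\<delta> > 0"
    and freq: "\<And>i. i < K \<Longrightarrow> \<exists>\<^sub>F n in sequentially. f i n (y i) / real n \<ge> \<alpha> i"
  obtains x where "\<And>i. i < K \<Longrightarrow> \<exists>\<^sub>F n in sequentially. f i n x / real n \<ge> \<alpha> i - \<delta>"
proof (cases "K = 0")
  case False
  have "\<forall>i\<in>{..<K}. \<exists>\<epsilon>>0. \<forall>x a n y. (\<forall>j. a j * Suc j \<le> n j) \<longrightarrow> (\<forall>j. j < n j) \<longrightarrow>
    (\<forall>j. \<forall>p<n j. dist ((T ^^ (p + a j)) x) ((T ^^ p) (y j)) \<le> \<epsilon>) \<longrightarrow>
    (\<forall>\<^sub>F j in sequentially. \<bar>f i (a j + n j) x / real (a j + n j) - f i (n j) (y j) / real (n j)\<bar> \<le> \<delta>)"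
    using AAP_shadowing[OF cpt T f \<open>\<delta> > 0\<close>] by simp
  from bchoice[OF this] obtain \<epsilon> where \<epsilon>': "\<forall>i\<in>{..<K}. \<epsilon> i > 0 \<and> (\<forall>x a n y. (\<forall>j. a j * Suc j \<le> n j) \<longrightarrow> (\<forall>j. j < n j) \<longrightarrow>
    (\<forall>j. \<forall>p<n j. dist ((T ^^ (p + a j)) x) ((T ^^ p) (y j)) \<le> \<epsilon> i) \<longrightarrow>
    (\<forall>\<^sub>F j in sequentially. \<bar>f i (a j + n j) x / real (a j + n j) - f i (n j) (y j) / real (n j)\<bar> \<le> \<delta>))"
    by (rule exE)
  then have \<epsilon>_pos: "\<And>i. i < K \<Longrightarrow> \<epsilon> i > 0"
    by simp
  have \<epsilon>: "\<forall>\<^sub>F j in sequentially. \<bar>f i (a j + n j) x / real (a j + n j) - f i (n j) (y j) / real (n j)\<bar> \<le> \<delta>"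
    if "i < K" "\<And>j. a j * Suc j \<le> n j" "\<And>j. j < n j"
      "\<And>j p. p < n j \<Longrightarrow> dist ((T ^^ (p + a j)) x) ((T ^^ p) (y j)) \<le> \<epsilon> i" for i x a n y
    using \<epsilon>' that unfolding Ball_def lessThan_iff by blast
  \<comment> \<open>The least of finitely many radii, so that one shadowing point serves all
    potentials.\<close>
  define e where "e = Min (\<epsilon> ` {..<K})"
  have e: "e > 0" "\<And>i. i < K \<Longrightarrow> e \<le> \<epsilon> i"
    using \<epsilon>_pos False by (auto simp: e_def lessThan_empty_iff)
  have mod_K: "j mod K < K" for j
    using False by simp
  obtain x a n where n: "\<And>j. f (j mod K) (n j) (y (j mod K)) / real (n j) \<ge> \<alpha> (j mod K)"
    and an: "\<And>j. a j * Suc j \<le> n j" "\<And>j. j < n j"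
    and sh: "\<And>j p. p < n j \<Longrightarrow> dist ((T ^^ (p + a j)) x) ((T ^^ p) (y (j mod K))) \<le> e"
    by (rule specification_long_segments[where P = "\<lambda>j n. f (j mod K) n (y (j mod K)) / real n \<ge> \<alpha> (j mod K)"
        and y = "\<lambda>j. y (j mod K)", OF cpt T spec e(1) freq[OF mod_K]])
      (rule that, assumption+)
  have "\<exists>\<^sub>F n in sequentially. f i n x / real n \<ge> \<alpha> i - \<delta>" if i: "i < K" for i
  proof -
    have "\<forall>\<^sub>F j in sequentially. \<bar>f i (a j + n j) x / real (a j + n j) - f i (n j) (y (j mod K)) / real (n j)\<bar> \<le> \<delta>"
    proof (rule \<epsilon>[OF i an])
      show "dist ((T ^^ (p + a j)) x) ((T ^^ p) (y (j mod K))) \<le> \<epsilon> i" if "p < n j" for j p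
        using sh[OF that] e(2)[OF i] by (rule order_trans)
    qed
    then obtain J where J: "\<And>j. j \<ge> J \<Longrightarrow>
        \<bar>f i (a j + n j) x / real (a j + n j) - f i (n j) (y (j mod K)) / real (n j)\<bar> \<le> \<delta>"
      unfolding eventually_sequentially by blast
    have "\<exists>n\<ge>M. f i n x / real n \<ge> \<alpha> i - \<delta>" for M
    proof -
      \<comment> \<open>A segment index beyond both \<open>J\<close> and \<open>M\<close> at which
        the orbit of \<open>y i\<close> has its turn; only there is \<open>f i\<close> known to be
        large.\<close>
      define j where "j = i + K * (J + M)"
      have "J + M \<le> K * (J + M)"
        using False by simp
      then have j: "j mod K = i" "J \<le> j" "M \<le> j"
        using i unfolding j_def by (simp, linarith+)
      have "f i (a j + n j) x / real (a j + n j) \<ge> \<alpha> i - \<delta>"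
        using J[OF j(2)] n[of j] unfolding j(1) by linarith
      moreover have "M \<le> a j + n j"
        using an(2)[of j] j(3) by simp
      ultimately show ?thesis by blast
    qed
    then show ?thesis
      by (simp add: frequently_sequentially)
  qed
  then show thesis
    by (rule that)
qed (use that in auto)

section \<open>Comparison of the suprema\<close>

lemma SUP_ergodic_measures_ratio:
  fixes T :: "'a::metric_space \<Rightarrow> 'a"
  assumes cpt: "compact (UNIV :: 'a set)" and T: "continuous_on UNIV T" and f: "AAP T f" and g: "AAP T g"
    and \<sigma>: "\<sigma> > 0" "\<And>n x. n \<ge> 1 \<Longrightarrow> g n x / real n \<ge> \<sigma>"
  shows "(SUP \<mu>\<in>ergodic_measures T. ereal (pot_star f \<mu> / pot_star g \<mu>))
       = (SUP \<mu>\<in>invariant_measures T. ereal (pot_star f \<mu> / pot_star g \<mu>))"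
proof (rule antisym)
  have sub: "ergodic_measures T \<subseteq> invariant_measures T"
    by (auto simp: ergodic_measures_def)
  then show "(SUP \<mu>\<in>ergodic_measures T. ereal (pot_star f \<mu> / pot_star g \<mu>))
       \<le> (SUP \<mu>\<in>invariant_measures T. ereal (pot_star f \<mu> / pot_star g \<mu>))"
    by (rule SUP_subset_mono) simp
  show "(SUP \<mu>\<in>invariant_measures T. ereal (pot_star f \<mu> / pot_star g \<mu>))
       \<le> (SUP \<mu>\<in>ergodic_measures T. ereal (pot_star f \<mu> / pot_star g \<mu>))" (is "_ \<le> ?S")
  proof (rule SUP_least)
    fix \<mu> assume \<mu>: "\<mu> \<in> invariant_measures T"
    define c where "c = pot_star f \<mu> / pot_star g \<mu>"
    \<comment> \<open>The mean of \<open>D\<close> vanishes at \<open>\<mu>\<close>, and an ergodic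
      measure on which it is almost nonnegative has ratio almost \<open>c\<close>.\<close>
    define D where "D n x = 1 * f n x + (- c) * g n x" for n x
    have D: "AAP T D"
      unfolding D_def[abs_def] by (rule AAP_linear[OF cpt T f g])
    have g_ge: "pot_star g \<nu> \<ge> \<sigma>" if "\<nu> \<in> invariant_measures T" for \<nu>
      by (rule pot_star_ge[OF cpt T g that \<sigma>(2)])
    have D_star: "pot_star D \<nu> = pot_star f \<nu> - c * pot_star g \<nu>" if "\<nu> \<in> invariant_measures T" for \<nu>
      unfolding D_def[abs_def] pot_star_linear[OF cpt T f g that] by simp
    have "ereal c \<le> ?S + ereal \<tau>" if "\<tau> > 0" for \<tau>
    proof -
      \<comment> \<open>Three losses of \<delta>: exchanging \<open>D\<close> and \<open>h\<close>
        at \<open>\<mu>\<close> and at \<open>\<nu>\<close>, and the near-maximality of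
        \<open>\<nu>\<close>. Their sum \<tau>\<sigma> becomes at most \<tau> on division by
        \<open>pot_star g \<nu> \<ge> \<sigma>\<close>.\<close>
      define \<delta> where "\<delta> = \<tau> * \<sigma> / 3"
      have \<delta>: "\<delta> > 0"
        using \<sigma>(1) that by (simp add: \<delta>_def)
      then obtain h where h: "continuous_on UNIV h"
        "\<forall>\<^sub>F n in sequentially. \<forall>x. \<bar>D n x - birkhoff_sum T n h x\<bar> \<le> \<delta> * real n"
        using D unfolding AAP_iff[OF cpt T] by blast
      obtain \<nu> where \<nu>: "\<nu> \<in> ergodic_measures T" "(\<integral>x. h x \<partial>\<nu>) \<ge> (\<integral>x. h x \<partial>\<mu>) - \<delta>"
        using ergodic_measure_almost_maximal[OF cpt T \<mu> h(1) \<delta>] by blast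
      have \<nu>_inv: "\<nu> \<in> invariant_measures T"
        using \<nu>(1) sub by blast
      have "pot_star D \<mu> = 0"
        using g_ge[OF \<mu>] \<sigma>(1) by (simp add: D_star[OF \<mu>] c_def)
      then have "pot_star D \<nu> \<ge> - (3 * \<delta>)"
        using pot_star_close[OF cpt T D \<mu> h] pot_star_close[OF cpt T D \<nu>_inv h] \<nu>(2) by linarith
      moreover have "\<tau> * \<sigma> \<le> \<tau> * pot_star g \<nu>"
        using g_ge[OF \<nu>_inv] that by (intro mult_left_mono) auto
      ultimately have "pot_star f \<nu> + \<tau> * pot_star g \<nu> \<ge> c * pot_star g \<nu>"
        unfolding D_star[OF \<nu>_inv] \<delta>_def by simp
      then have "c \<le> pot_star f \<nu> / pot_star g \<nu> + \<tau>"
        using g_ge[OF \<nu>_inv] \<sigma>(1) by (simp add: field_simps)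
      then have "ereal c \<le> ereal (pot_star f \<nu> / pot_star g \<nu>) + ereal \<tau>"
        by simp
      also have "\<dots> \<le> ?S + ereal \<tau>"
        using \<nu>(1) by (intro add_right_mono SUP_upper)
      finally show ?thesis .
    qed
    then have "ereal c \<le> ?S"
      by (rule ereal_le_epsilon2)
    then show "ereal (pot_star f \<mu> / pot_star g \<mu>) \<le> ?S"
      by (simp add: c_def)
  qed
qed

text \<open>Since \<open>\<psi> n x\<close> is positive and at most \<open>B * n\<close>, a
  deviation \<eta> of the normalised difference moves the ratio at least \<open>\<eta> / B\<close>
  away from \<open>c\<close>; doing so infinitely often on both sides excludes a limit.\<close>

lemma not_convergent_ratioI:
  fixes T :: "'a::metric_space \<Rightarrow> 'a"
  assumes cpt: "compact (UNIV :: 'a set)" and T: "continuous_on UNIV T" and \<psi>: "AAP T \<psi>"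
    and \<sigma>: "\<sigma> > 0" "\<And>n x. n \<ge> 1 \<Longrightarrow> \<psi> n x / real n \<ge> \<sigma>" and "\<eta> > 0"
    and up: "\<exists>\<^sub>F n in sequentially. (\<phi> n x - c * \<psi> n x) / real n \<ge> \<eta>"
    and down: "\<exists>\<^sub>F n in sequentially. (\<phi> n x - c * \<psi> n x) / real n \<le> - \<eta>"
  shows "\<not> convergent (\<lambda>n. \<phi> n x / \<psi> n x)"
proof
  assume "convergent (\<lambda>n. \<phi> n x / \<psi> n x)"
  then obtain l where l: "(\<lambda>n. \<phi> n x / \<psi> n x) \<longlonglongrightarrow> l"
    by (auto simp: convergent_def)
  obtain B where B: "B > 0" "\<forall>\<^sub>F n in sequentially. \<forall>x. \<bar>\<psi> n x\<bar> \<le> B * real n"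
    using AAP_bounded[OF cpt T \<psi>] by blast
  have ev: "\<forall>\<^sub>F n in sequentially. n \<ge> 1 \<and> 0 < \<psi> n x \<and> \<psi> n x \<le> B * real n"
    using B(2) eventually_ge_at_top[of 1]
  proof eventually_elim
    case (elim n)
    have "0 < \<psi> n x / real n"
      using \<sigma>(2)[OF elim(2), of x] \<sigma>(1) by linarith
    then show ?case
      using elim spec[OF elim(1), of x] by (simp add: zero_less_divide_iff)
  qed
  have "\<exists>\<^sub>F n in sequentially. \<phi> n x / \<psi> n x \<ge> c + \<eta> / B"
    using frequently_eventually_frequently[OF up ev]
  proof (rule frequently_elim1, elim conjE)
    fix n assume n: "(\<phi> n x - c * \<psi> n x) / real n \<ge> \<eta>" "n \<ge> 1" "0 < \<psi> n x" "\<psi> n x \<le> B * real n"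
    have "\<eta> / B * \<psi> n x \<le> \<eta> / B * (B * real n)"
      using n(4) B(1) \<open>\<eta> > 0\<close> by (intro mult_left_mono) auto
    also have "\<dots> \<le> \<phi> n x - c * \<psi> n x"
      using n(1,2) B(1) by (simp add: field_simps)
    finally have "(c + \<eta> / B) * \<psi> n x \<le> \<phi> n x"
      unfolding distrib_right by linarith
    then show "\<phi> n x / \<psi> n x \<ge> c + \<eta> / B"
      by (rule iffD2[OF pos_le_divide_eq[OF n(3)]])
  qed
  then have "\<not> l < c + \<eta> / B"
    using order_tendstoD(2)[OF l, of "c + \<eta> / B"] unfolding frequently_def not_le by blast
  moreover have "\<exists>\<^sub>F n in sequentially. \<phi> n x / \<psi> n x \<le> c - \<eta> / B"
    using frequently_eventually_frequently[OF down ev]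
  proof (rule frequently_elim1, elim conjE)
    fix n assume n: "(\<phi> n x - c * \<psi> n x) / real n \<le> - \<eta>" "n \<ge> 1" "0 < \<psi> n x" "\<psi> n x \<le> B * real n"
    have "\<phi> n x - c * \<psi> n x \<le> - (\<eta> / B * (B * real n))"
      using n(1,2) B(1) by (simp add: field_simps)
    moreover have "\<eta> / B * \<psi> n x \<le> \<eta> / B * (B * real n)"
      using n(4) B(1) \<open>\<eta> > 0\<close> by (intro mult_left_mono) auto
    ultimately have "\<phi> n x \<le> (c - \<eta> / B) * \<psi> n x"
      unfolding left_diff_distrib by linarith
    then show "\<phi> n x / \<psi> n x \<le> c - \<eta> / B"
      by (rule iffD2[OF pos_divide_le_eq[OF n(3)]])
  qed
  then have "\<not> c - \<eta> / B < l"
    using order_tendstoD(1)[OF l, of "c - \<eta> / B"] unfolding frequently_def not_le by blast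
  ultimately have "\<eta> / B \<le> 0"
    by simp
  then show False
    using \<open>\<eta> > 0\<close> B(1) by (simp add: divide_le_0_iff)
qed

lemma irregular_point_near_measure:
  fixes T :: "'a::metric_space \<Rightarrow> 'a"
  assumes cpt: "compact (UNIV :: 'a set)" and T: "continuous_on UNIV T" and spec: "specification_property T"
    and f: "AAP T f" and \<phi>: "AAP T \<phi>" and g: "AAP T g" and \<psi>: "AAP T \<psi>"
    and \<sigma>: "\<sigma> > 0" "\<And>n x. n \<ge> 1 \<Longrightarrow> g n x / real n \<ge> \<sigma>" "\<And>n x. n \<ge> 1 \<Longrightarrow> \<psi> n x / real n \<ge> \<sigma>"
    and \<mu>: "\<mu> \<in> invariant_measures T" and \<mu>1: "\<mu>1 \<in> invariant_measures T" and \<mu>2: "\<mu>2 \<in> invariant_measures T"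
    and less: "pot_star \<phi> \<mu>1 / pot_star \<psi> \<mu>1 < pot_star \<phi> \<mu>2 / pot_star \<psi> \<mu>2" and "\<tau> > 0"
  obtains x where "x \<in> irregular_set \<phi> \<psi>"
    "limsup (\<lambda>n. ereal (f n x / g n x)) \<ge> ereal (pot_star f \<mu> / pot_star g \<mu> - \<tau>)"
proof -
  define c where "c = pot_star f \<mu> / pot_star g \<mu>"
  obtain b where b: "pot_star \<phi> \<mu>1 / pot_star \<psi> \<mu>1 < b" "b < pot_star \<phi> \<mu>2 / pot_star \<psi> \<mu>2"
    using dense[OF less] by blast
  define D where "D n x = 1 * f n x + (- c) * g n x" for n x
  \<comment> \<open>The sign \<open>s\<close> turns the deviations on both sides of \<open>b\<close>
    into statements that some potential is infinitely often large, the form which shadowing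
    preserves.\<close>
  define E where "E s n x = s * \<phi> n x + (- s * b) * \<psi> n x" for s n x
  have D: "AAP T D"
    unfolding D_def[abs_def] by (rule AAP_linear[OF cpt T f g])
  have E: "AAP T (E s)" for s
    unfolding E_def[abs_def] by (rule AAP_linear[OF cpt T \<phi> \<psi>])
  have g_pos: "pot_star g \<mu> > 0"
    using pot_star_ge[OF cpt T g \<mu> \<sigma>(2)] \<sigma>(1) by simp
  have \<psi>_pos: "pot_star \<psi> \<nu> > 0" if "\<nu> \<in> invariant_measures T" for \<nu>
    using pot_star_ge[OF cpt T \<psi> that \<sigma>(3)] \<sigma>(1) by simp
  have D_star: "pot_star D \<mu> = 0"
    unfolding D_def[abs_def] pot_star_linear[OF cpt T f g \<mu>] using g_pos by (simp add: c_def)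
  have E_star: "pot_star (E s) \<nu> = s * (pot_star \<phi> \<nu> - b * pot_star \<psi> \<nu>)" if "\<nu> \<in> invariant_measures T" for s \<nu>
    unfolding E_def[abs_def] pot_star_linear[OF cpt T \<phi> \<psi> that] by (simp add: algebra_simps)
  have E_pos: "pot_star (E 1) \<mu>2 > 0" "pot_star (E (-1)) \<mu>1 > 0"
    using b \<psi>_pos[OF \<mu>1] \<psi>_pos[OF \<mu>2] by (simp_all add: E_star[OF \<mu>1] E_star[OF \<mu>2] field_simps)
  \<comment> \<open>A third of the smaller mean: \<open>2 * \<eta>\<close> is strictly below both
    means, and after the shadowing loss \<open>\<delta> \<le> \<eta>\<close> at least
    \<open>\<eta>\<close> remains.\<close>
  define \<eta> where "\<eta> = min (pot_star (E 1) \<mu>2) (pot_star (E (-1)) \<mu>1) / 3"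
  have \<eta>: "\<eta> > 0" "2 * \<eta> < pot_star (E 1) \<mu>2" "2 * \<eta> < pot_star (E (-1)) \<mu>1"
    using E_pos unfolding \<eta>_def min_def by auto
  \<comment> \<open>\<open>D\<close> loses \<delta> twice, since its mean 0 only yields a point at
    level -\<delta>, and again by shadowing; \<open>2 * \<delta> \<le> \<tau> * \<sigma>\<close>
    pays for both.\<close>
  define \<delta> where "\<delta> = min \<eta> (\<tau> * \<sigma> / 2)"
  have \<delta>: "\<delta> > 0" "\<delta> \<le> \<eta>" "2 * \<delta> \<le> \<tau> * \<sigma>"
    using \<eta>(1) \<sigma>(1) \<open>\<tau> > 0\<close> by (auto simp: \<delta>_def)
  obtain y0 where y0: "\<exists>\<^sub>F n in sequentially. D n y0 / real n \<ge> - \<delta>"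
    using AAP_frequently_large[OF cpt T D \<mu>, of "- \<delta>"] D_star \<delta>(1) by auto
  obtain y1 where y1: "\<exists>\<^sub>F n in sequentially. E 1 n y1 / real n \<ge> 2 * \<eta>"
    using AAP_frequently_large[OF cpt T E \<mu>2 \<eta>(2)] by auto
  obtain y2 where y2: "\<exists>\<^sub>F n in sequentially. E (-1) n y2 / real n \<ge> 2 * \<eta>"
    using AAP_frequently_large[OF cpt T E \<mu>1 \<eta>(3)] by auto
  define F where "F i = (if i = 0 then D else if i = 1 then E 1 else E (-1))" for i :: nat
  define y where "y i = (if i = 0 then y0 else if i = 1 then y1 else y2)" for i :: nat
  define \<alpha> where "\<alpha> i = (if i = 0 then - \<delta> else 2 * \<eta>)" for i :: nat
  obtain x where x: "\<And>i. i < 3 \<Longrightarrow> \<exists>\<^sub>F n in sequentially. F i n x / real n \<ge> \<alpha> i - \<delta>"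
  proof (rule specification_common_point[where K = 3 and f = F and \<delta> = \<delta> and y = y and \<alpha> = \<alpha>, OF cpt T spec])
    show "AAP T (F i)" for i
      using D E by (simp add: F_def)
    show "\<exists>\<^sub>F n in sequentially. F i n (y i) / real n \<ge> \<alpha> i" for i
      using y0 y1 y2 by (simp add: F_def y_def \<alpha>_def)
    show "\<delta> > 0" by fact
  qed (rule that, assumption)
  have x0: "\<exists>\<^sub>F n in sequentially. D n x / real n \<ge> - 2 * \<delta>"
    using x[of 0] by (simp add: F_def \<alpha>_def)
  have "\<exists>\<^sub>F n in sequentially. (\<phi> n x - b * \<psi> n x) / real n \<ge> \<eta>"
    using x[of 1] by (rule frequently_elim1) (use \<delta> in \<open>auto simp: F_def \<alpha>_def E_def\<close>)
  moreover have "\<exists>\<^sub>F n in sequentially. (\<phi> n x - b * \<psi> n x) / real n \<le> - \<eta>"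
    using x[of 2]
    by (rule frequently_elim1) (use \<delta> in \<open>auto simp: F_def \<alpha>_def E_def diff_divide_distrib add_divide_distrib\<close>)
  ultimately have "\<not> convergent (\<lambda>n. \<phi> n x / \<psi> n x)"
    using not_convergent_ratioI[where \<phi> = \<phi> and c = b and x = x, OF cpt T \<psi> \<sigma>(1,3) \<eta>(1)] by blast
  then have "x \<in> irregular_set \<phi> \<psi>"
    by (simp add: irregular_set_def)
  moreover have "ereal (c - \<tau>) \<le> limsup (\<lambda>n. ereal (f n x / g n x))"
  \<comment> \<open>A smaller limsup would give a time \<open>n\<close> with \<open>-2 \<delta> n
    \<le> D n x < -\<tau> g n x \<le> -\<tau> \<sigma> n\<close>, against the choice of
    \<open>\<delta>\<close>.\<close>
  proof (rule ccontr)
    assume "\<not> ereal (c - \<tau>) \<le> limsup (\<lambda>n. ereal (f n x / g n x))"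
    then have "\<forall>\<^sub>F n in sequentially. ereal (f n x / g n x) < ereal (c - \<tau>)"
      by (intro Limsup_lessD) (simp add: not_le)
    then have "\<forall>\<^sub>F n in sequentially. f n x / g n x < c - \<tau> \<and> n \<ge> 1"
      using eventually_ge_at_top[of 1] by eventually_elim simp
    then obtain n where n: "D n x / real n \<ge> - 2 * \<delta>" "f n x / g n x < c - \<tau>" "n \<ge> 1"
      using frequently_eventually_frequently[OF x0] frequently_ex by fastforce
    have g_n: "\<sigma> * real n \<le> g n x"
      using \<sigma>(2)[OF n(3), of x] n(3) by (simp add: field_simps)
    moreover have "\<sigma> * real n > 0"
      using \<sigma>(1) n(3) by simp
    ultimately have "f n x < (c - \<tau>) * g n x"
      using n(2) by (simp add: divide_less_eq)
    moreover have "f n x - c * g n x \<ge> - (\<tau> * \<sigma>) * real n"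
    proof -
      have "- (\<tau> * \<sigma>) * real n \<le> (- 2 * \<delta>) * real n"
        using \<delta>(3) by (intro mult_right_mono) auto
      also have "\<dots> \<le> f n x - c * g n x"
        using n(1,3) by (simp add: D_def le_divide_eq)
      finally show ?thesis .
    qed
    moreover have "\<tau> * (\<sigma> * real n) \<le> \<tau> * g n x"
      using g_n \<open>\<tau> > 0\<close> by (intro mult_left_mono) auto
    ultimately show False
      by (simp add: algebra_simps)
  qed
  ultimately show thesis
    using that by (simp add: c_def)
qed

theorem theoremF:
  fixes T :: "'a::metric_space \<Rightarrow> 'a"
    and f \<phi> g \<psi> :: "nat \<Rightarrow> 'a \<Rightarrow> real"
    and \<sigma> :: real
  assumes "compact (UNIV :: 'a set)"
    and "continuous_on UNIV T"
    and "specification_property T"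
    and "AAP T f" and "AAP T \<phi>" and "AAP T g" and "AAP T \<psi>"
    and "\<sigma> > 0"
    and "\<And>n x. n \<ge> 1 \<Longrightarrow> g n x / real n \<ge> \<sigma>"
    and "\<And>n x. n \<ge> 1 \<Longrightarrow> \<psi> n x / real n \<ge> \<sigma>"
    and "(INF \<mu>\<in>invariant_measures T. ereal (pot_star \<phi> \<mu> / pot_star \<psi> \<mu>))
           < (SUP \<mu>\<in>invariant_measures T. ereal (pot_star \<phi> \<mu> / pot_star \<psi> \<mu>))"
  shows "(SUP \<mu>\<in>ergodic_measures T. ereal (pot_star f \<mu> / pot_star g \<mu>))
           = (SUP \<mu>\<in>invariant_measures T. ereal (pot_star f \<mu> / pot_star g \<mu>))
    \<and> (SUP \<mu>\<in>invariant_measures T. ereal (pot_star f \<mu> / pot_star g \<mu>))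
           = (SUP \<mu>\<in>(\<Union>x\<in>irregular_set \<phi> \<psi>. empirical_limits T x). ereal (pot_star f \<mu> / pot_star g \<mu>))
    \<and> (SUP \<mu>\<in>(\<Union>x\<in>irregular_set \<phi> \<psi>. empirical_limits T x). ereal (pot_star f \<mu> / pot_star g \<mu>))
           = (SUP x\<in>irregular_set \<phi> \<psi>. limsup (\<lambda>n. ereal (f n x / g n x)))"
proof -
  note cpt = assms(1) and T = assms(2) and spec = assms(3) and f = assms(4) and \<phi> = assms(5)
    and g = assms(6) and \<psi> = assms(7) and \<sigma> = assms(8-10)
  let ?q = "\<lambda>\<mu>. ereal (pot_star f \<mu> / pot_star g \<mu>)"
  let ?L = "SUP x\<in>irregular_set \<phi> \<psi>. limsup (\<lambda>n. ereal (f n x / g n x))"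
  have third: "(SUP \<mu>\<in>(\<Union>x\<in>irregular_set \<phi> \<psi>. empirical_limits T x). ?q \<mu>) = ?L"
    unfolding SUP_UNION
    by (intro SUP_cong refl limsup_ratio_eq_SUP_empirical_limits[OF cpt T f g \<sigma>(1,2), symmetric])
  have "(SUP \<mu>\<in>(\<Union>x\<in>irregular_set \<phi> \<psi>. empirical_limits T x). ?q \<mu>) \<le> (SUP \<mu>\<in>invariant_measures T. ?q \<mu>)"
    using empirical_limits_subset_invariant[OF cpt T] by (intro SUP_subset_mono) auto
  moreover have "(SUP \<mu>\<in>invariant_measures T. ?q \<mu>) \<le> ?L"
  proof (rule SUP_least)
    fix \<mu> assume \<mu>: "\<mu> \<in> invariant_measures T"
    obtain \<mu>1 \<mu>2 where \<mu>12: "\<mu>1 \<in> invariant_measures T" "\<mu>2 \<in> invariant_measures T"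
      "pot_star \<phi> \<mu>1 / pot_star \<psi> \<mu>1 < pot_star \<phi> \<mu>2 / pot_star \<psi> \<mu>2"
      using assms(11) unfolding less_SUP_iff INF_less_iff by auto
    have "?q \<mu> \<le> ?L + ereal \<tau>" if "\<tau> > 0" for \<tau>
    proof -
      obtain x where x: "x \<in> irregular_set \<phi> \<psi>"
        "ereal (pot_star f \<mu> / pot_star g \<mu> - \<tau>) \<le> limsup (\<lambda>n. ereal (f n x / g n x))"
        using irregular_point_near_measure[OF cpt T spec f \<phi> g \<psi> \<sigma> \<mu> \<mu>12 \<open>\<tau> > 0\<close>] by blast
      have "?q \<mu> = ereal (pot_star f \<mu> / pot_star g \<mu> - \<tau>) + ereal \<tau>"
        by simp
      also have "\<dots> \<le> ?L + ereal \<tau>"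
        using x by (intro add_right_mono) (auto intro: SUP_upper2)
      finally show ?thesis .
    qed
    then show "?q \<mu> \<le> ?L"
      by (rule ereal_le_epsilon2)
  qed
  \<comment> \<open>The circle closes: the supremum over empirical limits is at most that over
    invariant measures, which is at most \<open>?L\<close>, and \<open>?L\<close> is the first of
    these again.\<close>
  ultimately have "(SUP \<mu>\<in>invariant_measures T. ?q \<mu>)
      = (SUP \<mu>\<in>(\<Union>x\<in>irregular_set \<phi> \<psi>. empirical_limits T x). ?q \<mu>)"
    unfolding third by (rule antisym[rotated])
  then show ?thesis
    using SUP_ergodic_measures_ratio[OF cpt T f g \<sigma>(1,2)] third by blast
qed

end
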